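(* $[4,2,0,2]=[3,1,1,1]=5$ and $[2,0,2,0]=4$.
   Context: $\mathcal{Q}_n$ is the $n$-dimensional binary hypercube: its vertices are all binary sequences of length $n$, adjacent iff they differ in exactly one position. A vertex is even or odd according to the parity of its number of 1's; vertices of one parity are called red and those of the other parity green. A path covering of a graph is a set of vertex-disjoint paths that cover all vertices of the graph. A fault $\mathcal{F}$ in $\mathcal{Q}_n$ is a set of deleted vertices; its mass is $|\mathcal{F}|$ and its charge is $|r(\mathcal{F})-g(\mathcal{F})|$, where $r(\mathcal{F})$, $g(\mathcal{F})$ are the numbers of red and green vertices in $\mathcal{F}$. $\mathcal{Q}_n-\mathcal{F}$ is the subgraph induced by the non-deleted vertices. A pair of vertices (or a path, via its two endpoints) is neutral if the two vertices have opposite parity and charged if they have the same parity; a charged pair is red (green) if its elements are red (green). A set $\mathcal{E}$ of disjoint pairs of vertices is in balance with $\mathcal{F}$ if all vertices in the pairs lie in $\mathcal{Q}_n-\mathcal{F}$ and $r(\mathcal{F})-g(\mathcal{F})=g(\mathcal{E})-r(\mathcal{E})$, where $r(\mathcal{E})$, $g(\mathcal{E})$ are the numbers of red and green pairs in $\mathcal{E}$. For a fault $\mathcal{F}$ of mass $M$ and charge $C$ in $\mathcal{Q}_n$, one can freely prescribe ends for a path covering of $\mathcal{Q}_n-\mathcal{F}$ with $N$ neutral paths and $O$ charged paths if (i) there is at least one set $\mathcal{E}$ of disjoint pairs of vertices in balance with $\mathcal{F}$ containing exactly $N$ neutral and $O$ charged pairs, and (ii) for every such $\mathcal{E}$ there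 is a path covering of $\mathcal{Q}_n-\mathcal{F}$ whose set of pairs of end vertices is $\mathcal{E}$. For nonnegative integers $M,C,N,O$, $\mathcal{A}_{M,C,N,O}$ is the set of nonnegative integers $m$ such that $m\ge\log_2[M+C+2N+2O]$ and for every $n\ge m$ and every fault $\mathcal{F}$ of mass $M$ and charge $C$ in $\mathcal{Q}_n$ one can freely prescribe ends for a path covering of $\mathcal{Q}_n-\mathcal{F}$ with $N$ neutral and $O$ charged paths. $[M,C,N,O]$ is the smallest element of $\mathcal{A}_{M,C,N,O}$ if this set is nonempty (so an equality $[M,C,N,O]=m$ includes the assertion that the set is nonempty). *)

theory Defs
  imports Complex_Main "HOL-Library.Disjoint_Sets" "Graph_Theory.Graph_Theory"
begin

text \<open>
  An undirected graph is represented as a symmetric digraph. The binary digits 1 and 0 are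
  \<^const>\<open>True\<close> and \<^const>\<open>False\<close>.
\<close>

definition hypercube :: "nat \<Rightarrow> (bool list, bool list \<times> bool list) pre_digraph" where
  "hypercube n = with_proj
     \<lparr> pverts = {x. length x = n},
       parcs = {(x, y). length x = n \<and> length y = n \<and> card {i. i < n \<and> x ! i \<noteq> y ! i} = 1} \<rparr>"

text \<open>
  The colours could equally be assigned the other way round: swapping them
  leaves the charge, neutrality and the balance condition unchanged.
\<close>

definition red :: "bool list \<Rightarrow> bool" where
  "red x \<longleftrightarrow> even (count_list x True)"

definition green :: "bool list \<Rightarrow> bool" where
  "green x \<longleftrightarrow> odd (count_list x True)"

definition is_fault :: "nat \<Rightarrow> bool list set \<Rightarrow> bool" where
  "is_fault n F \<longleftrightarrow> F \<subseteq> verts (hypercube n)"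

definition mass :: "bool list set \<Rightarrow> nat" where
  "mass F = card F"

definition red_minus_green :: "bool list set \<Rightarrow> int" where
  "red_minus_green F = int (card {x \<in> F. red x}) - int (card {x \<in> F. green x})"

definition charge :: "bool list set \<Rightarrow> nat" where
  "charge F = nat \<bar>red_minus_green F\<bar>"

definition faulty_hypercube ::
    "nat \<Rightarrow> bool list set \<Rightarrow> (bool list, bool list \<times> bool list) pre_digraph" where
  "faulty_hypercube n F = induce_subgraph (hypercube n) (verts (hypercube n) - F)"

text \<open>A pair is unordered and has two distinct elements, i.e. it is a set of cardinality 2.\<close>

definition red_pair :: "bool list set \<Rightarrow> bool" where
  "red_pair e \<longleftrightarrow> card e = 2 \<and> (\<forall>x\<in>e. red x)"

definition green_pair :: "bool list set \<Rightarrow> bool" where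
  "green_pair e \<longleftrightarrow> card e = 2 \<and> (\<forall>x\<in>e. green x)"

definition charged_pair :: "bool list set \<Rightarrow> bool" where
  "charged_pair e \<longleftrightarrow> red_pair e \<or> green_pair e"

definition neutral_pair :: "bool list set \<Rightarrow> bool" where
  "neutral_pair e \<longleftrightarrow> card e = 2 \<and> (\<exists>x\<in>e. red x) \<and> (\<exists>x\<in>e. green x)"

definition disjoint_pairs :: "bool list set set \<Rightarrow> bool" where
  "disjoint_pairs E \<longleftrightarrow> (\<forall>e\<in>E. card e = 2) \<and> disjoint E"

definition in_balance :: "nat \<Rightarrow> bool list set set \<Rightarrow> bool list set \<Rightarrow> bool" where
  "in_balance n E F \<longleftrightarrow>
     \<Union>E \<subseteq> verts (faulty_hypercube n F) \<and>
     red_minus_green F = int (card {e \<in> E. green_pair e}) - int (card {e \<in> E. red_pair e})"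

text \<open>
  A path is given by a list of its vertices, in one of its two directions. As the lists
  in a covering have no vertex in common, no path can occur there in both directions.
\<close>

definition path_covering :: "('a, 'b) pre_digraph \<Rightarrow> 'a list set \<Rightarrow> bool" where
  "path_covering G P \<longleftrightarrow>
     (\<forall>p\<in>P. vpath p G) \<and>
     pairwise (\<lambda>p q. disjnt (set p) (set q)) P \<and>
     (\<Union>p\<in>P. set p) = verts G"

definition path_ends :: "'a list \<Rightarrow> 'a set" where
  "path_ends p = {hd p, last p}"

definition admissible_ends ::
    "nat \<Rightarrow> bool list set \<Rightarrow> nat \<Rightarrow> nat \<Rightarrow> bool list set set \<Rightarrow> bool" where
  "admissible_ends n F N Ch E \<longleftrightarrow>
     disjoint_pairs E \<and> in_balance n E F \<and>
     card {e \<in> E. neutral_pair e} = N \<and> card {e \<in> E. charged_pair e} = Ch"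

definition can_freely_prescribe_ends :: "nat \<Rightarrow> bool list set \<Rightarrow> nat \<Rightarrow> nat \<Rightarrow> bool" where
  "can_freely_prescribe_ends n F N Ch \<longleftrightarrow>
     (\<exists>E. admissible_ends n F N Ch E) \<and>
     (\<forall>E. admissible_ends n F N Ch E \<longrightarrow>
        (\<exists>P. path_covering (faulty_hypercube n F) P \<and> path_ends ` P = E))"

definition dims :: "nat \<Rightarrow> nat \<Rightarrow> nat \<Rightarrow> nat \<Rightarrow> nat set" where
  "dims M C N Ch =
     {m. real m \<ge> log 2 (real (M + C + 2 * N + 2 * Ch)) \<and>
         (\<forall>n\<ge>m. \<forall>F. is_fault n F \<and> mass F = M \<and> charge F = C \<longrightarrow>
            can_freely_prescribe_ends n F N Ch)}"

text \<open>The value is meaningful only if \<^term>\<open>dims M C N Ch\<close> is nonempty.\<close>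

definition least_dim :: "nat \<Rightarrow> nat \<Rightarrow> nat \<Rightarrow> nat \<Rightarrow> nat" where
  "least_dim M C N Ch = (LEAST m. m \<in> dims M C N Ch)"

end

theory Submission
  imports Defs
begin

text \<open>
  An end of a prescribed path can be deleted if a free neighbour is prescribed as the end instead:
  a covering of what remains extends to the deleted end. Hence from dimension 5 on,
  \<open>[4, 2, 0, 2]\<close> implies \<open>[3, 1, 1, 1]\<close>, and this implies \<open>[2, 0, 2, 0]\<close>, so that it suffices to
  cover a cube without \<open>r1, r2, r3\<close> (of one colour) and \<open>g\<close> (of the other one) by two paths whose
  ends \<open>a, b\<close> and \<open>c, d\<close> have the colour of \<open>g\<close>. This is done by induction on the dimension.

  The cube is split along a coordinate into two halves. If \<open>g\<close> is on the same side as exactly one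
  of the \<open>r\<close>'s, then whatever the positions of \<open>a, b, c, d\<close> are, coverings of both halves with fewer
  deleted vertices, cut in front of an inner end where necessary, can be joined by edges across. If
  there is no such coordinate, the coordinates which isolate one of the \<open>r\<close>'s from the others and \<open>g\<close>
  serve the same purpose. Both arguments already work for a 5-dimensional cube on the basis of
  statements on 4-dimensional ones that are checked by a backtracking search.

  The bounds are sharp because of vertices with too few usable neighbours.
\<close>

section \<open>Paths in subcubes\<close>

text \<open>A path with both ends of one colour covers one vertex more of that colour, so the
  vertices deleted in a half dictate which kinds of paths can cover it, and the positions of
  \<open>a\<close>, \<open>b\<close>, \<open>c\<close>, \<open>d\<close> dictate how these have to
  cross. The obstacle is a half from which two of the \<open>r\<close>'s and \<open>g\<close> are
  deleted: one neutral and one charged path can cover it, but in dimension 4 not for all ends, so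
  that the induction cannot start there. In most cases an end of the neutral path can be chosen, and
  then \<open>weak_NG_rrg\<close> is enough. The ends are forced only if \<open>a\<close>,
  \<open>b\<close>, \<open>c\<close>, \<open>d\<close> all lie on the side of the isolated
  \<open>r\<close>. In dimension 5 this cannot happen for all isolating coordinates: when they are
  needed, there are at least three of them, and the four vertices, all opposite to \<open>g\<close>
  in these, would lie in a square, which has only two vertices of their colour. From dimension 6 on,
  the induction hypothesis supplies \<open>NG_rrg\<close> for the halves.\<close>

definition flip :: "nat \<Rightarrow> bool list \<Rightarrow> bool list" where
  "flip i x = x[i := \<not> x ! i]"

definition adjacent :: "bool list \<Rightarrow> bool list \<Rightarrow> bool" where
  "adjacent x y \<longleftrightarrow> (\<exists>i<length x. y = flip i x)"

lemma length_flip [simp]: "length (flip i x) = length x"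
  by (simp add: flip_def)

lemma nth_flip: "i < length x \<Longrightarrow> flip i x ! j = (if j = i then \<not> x ! i else x ! j)"
  by (simp add: flip_def nth_list_update)

text \<open>Beyond the end of the list \<open>flip\<close> does nothing, so no bound on
  \<open>i\<close> is needed. The involution demanded by the locale \<open>halves\<close> thus holds
  on all lists.\<close>

lemma flip_flip [simp]: "flip i (flip i x) = x"
  by (cases "i < length x") (auto simp: flip_def list_update_beyond)

lemma flip_inject: "flip i x = flip j x \<Longrightarrow> i < length x \<Longrightarrow> i = j"
  by (metis nth_flip flip_flip flip_def list_update_beyond not_le)

lemma red_flip: "i < length x \<Longrightarrow> red (flip i x) \<longleftrightarrow> \<not> red x"
proof -
  assume i: "i < length x"
  have "count_list x True = count_list (take i x) True + (if x ! i then 1 else 0) + count_list (drop (Suc i) x) True"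
    by (subst id_take_nth_drop[OF i]) simp
  moreover have "count_list (flip i x) True =
      count_list (take i x) True + (if x ! i then 0 else 1) + count_list (drop (Suc i) x) True"
    by (simp add: flip_def upd_conv_take_nth_drop[OF i])
  ultimately show ?thesis by (auto simp: red_def)
qed

lemma adjacent_sym: "adjacent x y \<Longrightarrow> adjacent y x"
  unfolding adjacent_def by (metis flip_flip length_flip)

lemma adjacent_red: "adjacent x y \<Longrightarrow> red y \<longleftrightarrow> \<not> red x"
  unfolding adjacent_def by (auto simp: red_flip)

lemma adjacent_flip: "i < length x \<Longrightarrow> adjacent x (flip i x)"
  unfolding adjacent_def by auto

text \<open>A path is recorded only by its ends and its vertex set, since nothing else matters when
  paths in disjoint sets are joined.\<close>

inductive spans :: "bool list \<Rightarrow> bool list \<Rightarrow> bool list set \<Rightarrow> bool" where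
  single: "spans a a {a}"
| step: "adjacent x a \<Longrightarrow> spans a b S \<Longrightarrow> x \<notin> S \<Longrightarrow> spans x b (insert x S)"

lemma spans_ends: "spans a b S \<Longrightarrow> a \<in> S \<and> b \<in> S"
  by (induction rule: spans.induct) auto

lemma spans_join:
  "spans a b S \<Longrightarrow> spans c d T \<Longrightarrow> adjacent b c \<Longrightarrow> S \<inter> T = {} \<Longrightarrow> spans a d (S \<union> T)"
proof (induction rule: spans.induct)
  case (single a)
  then show ?case using spans.step[of a c d T] by auto
next
  case (step x a b S)
  then have "spans a d (S \<union> T)" by auto
  then have "spans x d (insert x (S \<union> T))"
    using step by (intro spans.step) auto
  then show ?case by simp
qed

lemma spans_sym: "spans a b S \<Longrightarrow> spans b a S"
proof (induction rule: spans.induct)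
  case (step x a b S)
  then have "spans b x (S \<union> {x})"
    by (intro spans_join[OF _ spans.single]) (auto intro: adjacent_sym)
  then show ?case by simp
qed (rule spans.single)

lemma spans_cut:
  assumes "spans a b S" "d \<in> S" "d \<noteq> a"
  obtains z S1 S2 where "spans a z S1" "spans d b S2" "adjacent z d" "S1 \<inter> S2 = {}" "S = S1 \<union> S2"
proof -
  from assms have "\<exists>z S1 S2. spans a z S1 \<and> spans d b S2 \<and> adjacent z d \<and> S1 \<inter> S2 = {} \<and> S = S1 \<union> S2"
  proof (induction rule: spans.induct)
    case (step x a b S)
    show ?case
    proof (cases "d = a")
      case True
      then show ?thesis
        using step spans.single[of x]
        by (intro exI[of _ x] exI[of _ "{x}"] exI[of _ S]) auto
    next
      case False
      with step obtain z S1 S2 where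
        "spans a z S1" "spans d b S2" "adjacent z d" "S1 \<inter> S2 = {}" "S = S1 \<union> S2" by blast
      then show ?thesis
        using step spans.step[of x a z S1]
        by (intro exI[of _ z] exI[of _ "insert x S1"] exI[of _ S2]) auto
    qed
  qed auto
  then show ?thesis using that by blast
qed

lemma spans_first:
  assumes "spans a b S" "a \<noteq> b"
  obtains z T where "adjacent a z" "spans z b T" "a \<notin> T" "S = insert a T"
  using assms by (cases rule: spans.cases) auto

lemma spans_list:
  assumes "spans a b S"
  obtains p where "p \<noteq> []" "hd p = a" "last p = b" "set p = S" "distinct p" "successively adjacent p"
proof -
  from assms have "\<exists>p. p \<noteq> [] \<and> hd p = a \<and> last p = b \<and> set p = S \<and> distinct p \<and> successively adjacent p"
  proof (induction rule: spans.induct)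
    case (single a)
    show ?case by (rule exI[of _ "[a]"]) simp
  next
    case (step x a b S)
    then obtain p where "p \<noteq> []" "hd p = a" "last p = b" "set p = S" "distinct p" "successively adjacent p"
      by blast
    then show ?case using step
      by (intro exI[of _ "x # p"]) (auto simp: successively_Cons)
  qed
  then show ?thesis using that by blast
qed

definition two_paths ::
    "bool list set \<Rightarrow> bool list \<Rightarrow> bool list \<Rightarrow> bool list \<Rightarrow> bool list \<Rightarrow> bool" where
  "two_paths W a b c d \<longleftrightarrow> (\<exists>S T. spans a b S \<and> spans c d T \<and> S \<inter> T = {} \<and> S \<union> T = W)"

lemma two_pathsI: "spans a b S \<Longrightarrow> spans c d T \<Longrightarrow> S \<inter> T = {} \<Longrightarrow> S \<union> T = W \<Longrightarrow> two_paths W a b c d"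
  unfolding two_paths_def by blast

lemma two_pathsE:
  assumes "two_paths W a b c d"
  obtains S T where "spans a b S" "spans c d T" "S \<inter> T = {}" "S \<union> T = W"
  using assms unfolding two_paths_def by blast

lemma two_paths_swap: "two_paths W a b c d \<Longrightarrow> two_paths W c d a b"
  unfolding two_paths_def by (metis Int_commute Un_commute)

lemma two_paths_rev: "two_paths W a b c d \<Longrightarrow> two_paths W b a c d"
  unfolding two_paths_def using spans_sym by blast

lemma two_paths_rev2: "two_paths W a b c d \<Longrightarrow> two_paths W a b d c"
  unfolding two_paths_def using spans_sym by blast

text \<open>The source of the statements on a single path: two paths are prescribed with adjacent
  inner ends and then merged.\<close>

lemma two_paths_join:
  "two_paths W a x y b \<Longrightarrow> adjacent x y \<Longrightarrow> spans a b W"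
  unfolding two_paths_def using spans_join by blast

lemma two_paths_extend:
  assumes "two_paths W u b c d" "adjacent a u" "a \<notin> W"
  shows "two_paths (insert a W) a b c d"
proof -
  obtain S T where *: "spans u b S" "spans c d T" "S \<inter> T = {}" "S \<union> T = W"
    using assms(1) by (rule two_pathsE)
  show ?thesis
    by (rule two_pathsI[OF spans.step[OF assms(2) *(1)] *(2)]) (use * assms(3) in auto)
qed

text \<open>\<open>D\<close> is the set of free coordinates. Vertices keep the fixed ones too, so
  that the halves of a cube are subsets of it and nothing has to be re-indexed.\<close>

definition subcube :: "bool list \<Rightarrow> nat set \<Rightarrow> bool list set" where
  "subcube x D = {y. length y = length x \<and> (\<forall>i<length x. i \<notin> D \<longrightarrow> y ! i = x ! i)}"

definition cube :: "nat \<Rightarrow> bool list set \<Rightarrow> bool" where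
  "cube n V \<longleftrightarrow> (\<exists>x D. D \<subseteq> {..<length x} \<and> card D = n \<and> V = subcube x D)"

lemma subcube_rebase: "y \<in> subcube x D \<Longrightarrow> subcube y D = subcube x D"
  by (auto simp: subcube_def)

lemma subcube_length: "y \<in> subcube x D \<Longrightarrow> length y = length x"
  by (simp add: subcube_def)

lemma flip_in_subcube:
  "y \<in> subcube x D \<Longrightarrow> i \<in> D \<Longrightarrow> D \<subseteq> {..<length x} \<Longrightarrow> flip i y \<in> subcube x D"
  by (auto simp: subcube_def nth_flip subset_iff)

lemma subcube_half:
  assumes "i \<in> D" "D \<subseteq> {..<length x}"
  shows "subcube (x[i := b]) (D - {i}) = {y \<in> subcube x D. y ! i = b}"
  using assms by (auto simp: subcube_def nth_list_update subset_iff)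

lemma subcube_empty: "subcube x {} = {x}"
  by (auto simp: subcube_def intro: nth_equalityI)

lemma finite_subcube: "finite (subcube x D)"
  by (rule finite_subset[OF _ finite_lists_length_eq[of "UNIV :: bool set" "length x"]])
     (auto simp: subcube_def)

text \<open>The colour is a parameter, so that statements with \<open>k\<close> and
  \<open>\<not> k\<close> cover both ways of colouring.\<close>

definition cls :: "bool list set \<Rightarrow> bool \<Rightarrow> bool list set" where
  "cls V k = {v \<in> V. red v = k}"

lemma in_cls [simp]: "v \<in> cls V k \<longleftrightarrow> v \<in> V \<and> red v = k"
  by (simp add: cls_def)

text \<open>Halving along a free coordinate doubles the count. The induction starts at dimension 1,
  because a single vertex has only one colour.\<close>

lemma card_cls_subcube:
  "D \<subseteq> {..<length x} \<Longrightarrow> card D = Suc m \<Longrightarrow> card (cls (subcube x D) k) = 2 ^ m"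
proof (induction m arbitrary: x D)
  case 0
  then obtain i where D: "D = {i}" by (metis One_nat_def card_1_singletonE)
  with 0 have i: "i < length x" by auto
  have halves: "{y \<in> subcube x D. y ! i = b} = {x[i := b]}" for b
    using subcube_half[of i D x b] 0 by (simp add: D subcube_empty)
  have "subcube x D = {y \<in> subcube x D. y ! i = (x ! i)} \<union> {y \<in> subcube x D. y ! i = (\<not> x ! i)}" by blast
  then have "subcube x D = {x, flip i x}" unfolding halves by (simp add: flip_def insert_commute)
  then have "cls (subcube x D) k = {if red x = k then x else flip i x}"
    using red_flip[OF i] by (auto simp: cls_def)
  then show ?case by simp
next
  case (Suc m)
  then obtain i where i: "i \<in> D" by fastforce
  have fin: "finite D" using Suc by (meson finite_lessThan finite_subset)
  have IH: "card (cls (subcube (x[i := b]) (D - {i})) k) = 2 ^ m" for b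
    using Suc i fin by (intro Suc.IH) auto
  have "cls (subcube x D) k =
      cls (subcube (x[i := True]) (D - {i})) k \<union> cls (subcube (x[i := False]) (D - {i})) k"
    using subcube_half[OF i Suc.prems(1)] by (auto simp: cls_def)
  moreover have "cls (subcube (x[i := True]) (D - {i})) k \<inter> cls (subcube (x[i := False]) (D - {i})) k = {}"
    using subcube_half[OF i Suc.prems(1)] by (auto simp: cls_def)
  moreover have "finite (cls (subcube y E) k)" for y E
    by (simp add: cls_def finite_subcube)
  ultimately show ?case using IH by (simp add: card_Un_disjoint)
qed

text \<open>Each colour class has at least \<open>2 ^ 3\<close> vertices, so that up to 7 vertices
  can be avoided.\<close>

lemma pick_vertex:
  assumes "cube n V" "4 \<le> n" "length xs < 8"
  obtains v where "v \<in> V" "red v = k" "v \<notin> set xs"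
proof -
  obtain x D where D: "D \<subseteq> {..<length x}" "card D = n" "V = subcube x D"
    using assms(1) unfolding cube_def by blast
  then have "card (cls V k) = 2 ^ (n - 1)"
    using card_cls_subcube[of D x "n - 1" k] assms(2) by simp
  also have "\<dots> \<ge> 2 ^ 3" using assms(2) by (intro power_increasing) auto
  finally have "card (set xs) < card (cls V k)"
    using assms(3) card_length[of xs] by simp
  then obtain v where "v \<in> cls V k - set xs"
    by (metis List.finite_set all_not_in_conv card_mono Diff_eq_empty_iff not_le)
  then show ?thesis using that by auto
qed

lemma pick_neighbour:
  assumes "cube n V" "v \<in> V" "length xs < n"
  obtains w where "w \<in> V" "adjacent v w" "red w = (\<not> red v)" "w \<notin> set xs"
proof -
  obtain x D where D: "D \<subseteq> {..<length x}" "card D = n" "V = subcube x D"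
    using assms(1) unfolding cube_def by blast
  have len: "length v = length x" using assms(2) D(3) subcube_length by auto
  have "inj_on (\<lambda>i. flip i v) D"
    using flip_inject D(1) len by (auto simp: inj_on_def)
  then have "card ((\<lambda>i. flip i v) ` D) = n" using D(2) by (simp add: card_image)
  then have "card (set xs) < card ((\<lambda>i. flip i v) ` D)"
    using assms(3) card_length[of xs] by simp
  then obtain i where "i \<in> D" "flip i v \<notin> set xs"
    by (metis List.finite_set card_mono image_subset_iff not_le)
  then show ?thesis
    using that[of "flip i v"] D len assms(2) flip_in_subcube adjacent_flip red_flip by auto
qed
text \<open>At most \<open>n + 3\<close> vertices are excluded, and a colour class has
  \<open>2 ^ (n - 1)\<close>. In dimension 4 this is 8 against 7, so that no more than 3 vertices
  may be listed.\<close>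

lemma pick_nonneighbour:
  assumes "cube n V" "4 \<le> n" "v \<in> V" "length xs \<le> 3"
  obtains w where "w \<in> V" "red w = k" "\<not> adjacent v w" "w \<notin> set xs"
proof -
  obtain x D where D: "D \<subseteq> {..<length x}" "card D = n" "V = subcube x D"
    using assms(1) unfolding cube_def by blast
  have fin: "finite D" using D(1) by (meson finite_lessThan finite_subset)
  have len: "length v = length x" using assms(3) D(3) subcube_length by auto
  have pow: "n + 3 < 2 ^ (n - 1)" if "4 \<le> n" for n :: nat
    using that
  proof (induction n rule: dec_induct)
    case (step n)
    then obtain m where "n = Suc m" using not0_implies_Suc by fastforce
    then show ?case using step by simp
  qed simp
  have "card (cls V k) = 2 ^ (n - 1)"
    using card_cls_subcube[of D x "n - 1" k] assms(2) D by simp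
  moreover have "card ((\<lambda>i. flip i v) ` D \<union> set xs) \<le> n + 3"
    using card_Un_le[of "(\<lambda>i. flip i v) ` D" "set xs"] card_image_le[OF fin, of "\<lambda>i. flip i v"]
      card_length[of xs] assms(4) D(2) by linarith
  ultimately have "card ((\<lambda>i. flip i v) ` D \<union> set xs) < card (cls V k)"
    using pow[OF assms(2)] by linarith
  moreover have "finite ((\<lambda>i. flip i v) ` D \<union> set xs)" using fin by simp
  ultimately obtain w where w: "w \<in> cls V k" "w \<notin> (\<lambda>i. flip i v) ` D \<union> set xs"
    by (metis card_mono not_le subsetI)
  have "\<not> adjacent v w"
  proof
    assume "adjacent v w"
    then obtain i where i: "i < length v" "w = flip i v" unfolding adjacent_def by blast
    then have "i \<notin> D" using w(2) by auto
    then have "w ! i = v ! i" using w(1) assms(3) i len by (auto simp: D(3) subcube_def)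
    then show False using i by (simp add: nth_flip)
  qed
  then show ?thesis using that w by auto
qed

section \<open>Two paths with prescribed ends\<close>

lemma spans_join3:
  assumes "spans a x S" "spans x' y' T" "spans y b U" "adjacent x x'" "adjacent y y'"
    "S \<inter> T = {}" "S \<inter> U = {}" "T \<inter> U = {}"
  shows "spans a b (S \<union> T \<union> U)"
  using spans_join[OF spans_join[OF assms(1,2,4,6)] assms(3)] assms adjacent_sym by blast

lemma two_paths_cross2:
  assumes "two_paths W1 a x c y" "two_paths W2 x' b y' d" "adjacent x x'" "adjacent y y'" "W1 \<inter> W2 = {}"
  shows "two_paths (W1 \<union> W2) a b c d"
proof -
  obtain S T where 1: "spans a x S" "spans c y T" "S \<inter> T = {}" "S \<union> T = W1"
    using assms(1) by (rule two_pathsE)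
  obtain S' T' where 2: "spans x' b S'" "spans y' d T'" "S' \<inter> T' = {}" "S' \<union> T' = W2"
    using assms(2) by (rule two_pathsE)
  have "spans a b (S \<union> S')" "spans c d (T \<union> T')"
    using 1 2 assms by (auto intro!: spans_join)
  then show ?thesis by (rule two_pathsI) (use 1 2 assms in auto)
qed

lemma two_paths_cross1:
  assumes "two_paths W1 a x c d" "spans x' b W2" "adjacent x x'" "W1 \<inter> W2 = {}"
  shows "two_paths (W1 \<union> W2) a b c d"
proof -
  obtain S T where 1: "spans a x S" "spans c d T" "S \<inter> T = {}" "S \<union> T = W1"
    using assms(1) by (rule two_pathsE)
  have "spans a b (S \<union> W2)"
    using 1 assms by (auto intro!: spans_join)
  then show ?thesis by (rule two_pathsI[OF _ 1(2)]) (use 1 assms in auto)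
qed

text \<open>The path from \<open>c\<close> to \<open>d\<close> runs in \<open>W2\<close> up to
  \<open>y\<close> and again from \<open>w\<close> on; the gap is bridged by the second path in
  \<open>W1\<close>.\<close>

lemma two_paths_detour:
  assumes "two_paths W1 a b y' w'" "two_paths W2 c y d w" "adjacent y y'" "adjacent w w'" "W1 \<inter> W2 = {}"
  shows "two_paths (W1 \<union> W2) a b c d"
proof -
  obtain S T where 1: "spans a b S" "spans y' w' T" "S \<inter> T = {}" "S \<union> T = W1"
    using assms(1) by (rule two_pathsE)
  obtain S' T' where 2: "spans c y S'" "spans d w T'" "S' \<inter> T' = {}" "S' \<union> T' = W2"
    using assms(2) by (rule two_pathsE)
  have "spans c d (S' \<union> T \<union> T')"
    by (rule spans_join3[OF 2(1) 1(2) spans_sym[OF 2(2)]]) (use 1 2 assms in auto)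
  then show ?thesis by (rule two_pathsI[OF 1(1)]) (use 1 2 assms in auto)
qed

text \<open>
  In the following names, the letters in front of \<open>_\<close> are the kinds of the prescribed paths and
  the letters behind it are the deleted vertices: \<open>r\<close> is a vertex of an arbitrary colour \<open>k\<close> and
  \<open>g\<close> one of the other colour, \<open>N\<close> is a neutral path and \<open>G\<close> a path with both ends of colour \<open>\<not> k\<close>.
  So \<open>GG_rrrg\<close> is the main part of \<open>[4, 2, 0, 2]\<close>.
\<close>

definition NN_rg :: "nat \<Rightarrow> bool" where
  "NN_rg n \<longleftrightarrow> (\<forall>V k r g p q s t. cube n V \<longrightarrow> {r, p, q} \<subseteq> cls V k \<longrightarrow> {g, s, t} \<subseteq> cls V (\<not> k) \<longrightarrow>
     distinct [r, p, q] \<longrightarrow> distinct [g, s, t] \<longrightarrow> two_paths (V - {r, g}) p s q t)"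

definition GG_rr :: "nat \<Rightarrow> bool" where
  "GG_rr n \<longleftrightarrow> (\<forall>V k r1 r2 a b c d. cube n V \<longrightarrow> {r1, r2} \<subseteq> cls V k \<longrightarrow> {a, b, c, d} \<subseteq> cls V (\<not> k) \<longrightarrow>
     r1 \<noteq> r2 \<longrightarrow> distinct [a, b, c, d] \<longrightarrow> two_paths (V - {r1, r2}) a b c d)"

definition G_rrg :: "nat \<Rightarrow> bool" where
  "G_rrg n \<longleftrightarrow> (\<forall>V k r1 r2 g a b. cube n V \<longrightarrow> {r1, r2} \<subseteq> cls V k \<longrightarrow> {g, a, b} \<subseteq> cls V (\<not> k) \<longrightarrow>
     r1 \<noteq> r2 \<longrightarrow> distinct [g, a, b] \<longrightarrow> spans a b (V - {r1, r2, g}))"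

definition NG_rrg :: "nat \<Rightarrow> bool" where
  "NG_rrg n \<longleftrightarrow> (\<forall>V k r1 r2 g p s a b. cube n V \<longrightarrow> {r1, r2, p} \<subseteq> cls V k \<longrightarrow> {g, s, a, b} \<subseteq> cls V (\<not> k) \<longrightarrow>
     distinct [r1, r2, p] \<longrightarrow> distinct [g, s, a, b] \<longrightarrow> two_paths (V - {r1, r2, g}) p s a b)"

text \<open>
  \<open>NG_rrg\<close> fails in dimension 4; there, some ends \<open>p\<close> of the neutral path have to be excluded.
\<close>

definition weak_NG_rrg :: "nat \<Rightarrow> bool" where
  "weak_NG_rrg n \<longleftrightarrow> (\<forall>V k r1 r2 g s a b x1 x2. cube n V \<longrightarrow> {r1, r2} \<subseteq> cls V k \<longrightarrow> {g, s, a, b} \<subseteq> cls V (\<not> k) \<longrightarrow>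
     r1 \<noteq> r2 \<longrightarrow> distinct [g, s, a, b] \<longrightarrow>
     (\<exists>p \<in> cls V k. p \<notin> {r1, r2, x1, x2} \<and> two_paths (V - {r1, r2, g}) p s a b))"

definition GG_rrrg :: "nat \<Rightarrow> bool" where
  "GG_rrrg n \<longleftrightarrow> (\<forall>V k r1 r2 r3 g a b c d. cube n V \<longrightarrow> {r1, r2, r3} \<subseteq> cls V k \<longrightarrow> {g, a, b, c, d} \<subseteq> cls V (\<not> k) \<longrightarrow>
     distinct [r1, r2, r3] \<longrightarrow> distinct [g, a, b, c, d] \<longrightarrow> two_paths (V - {r1, r2, r3, g}) a b c d)"

lemma NN_rgD: "NN_rg n \<Longrightarrow> cube n V \<Longrightarrow> {r, p, q} \<subseteq> cls V k \<Longrightarrow> {g, s, t} \<subseteq> cls V (\<not> k) \<Longrightarrow>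
     distinct [r, p, q] \<Longrightarrow> distinct [g, s, t] \<Longrightarrow> two_paths (V - {r, g}) p s q t"
  unfolding NN_rg_def by blast

lemma GG_rrD: "GG_rr n \<Longrightarrow> cube n V \<Longrightarrow> {r1, r2} \<subseteq> cls V k \<Longrightarrow> {a, b, c, d} \<subseteq> cls V (\<not> k) \<Longrightarrow>
     r1 \<noteq> r2 \<Longrightarrow> distinct [a, b, c, d] \<Longrightarrow> two_paths (V - {r1, r2}) a b c d"
  unfolding GG_rr_def by blast

lemma G_rrgD: "G_rrg n \<Longrightarrow> cube n V \<Longrightarrow> {r1, r2} \<subseteq> cls V k \<Longrightarrow> {g, a, b} \<subseteq> cls V (\<not> k) \<Longrightarrow>
     r1 \<noteq> r2 \<Longrightarrow> distinct [g, a, b] \<Longrightarrow> spans a b (V - {r1, r2, g})"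
  unfolding G_rrg_def by blast

lemma NG_rrgD: "NG_rrg n \<Longrightarrow> cube n V \<Longrightarrow> {r1, r2, p} \<subseteq> cls V k \<Longrightarrow> {g, s, a, b} \<subseteq> cls V (\<not> k) \<Longrightarrow>
     distinct [r1, r2, p] \<Longrightarrow> distinct [g, s, a, b] \<Longrightarrow> two_paths (V - {r1, r2, g}) p s a b"
  unfolding NG_rrg_def by blast

lemma weak_NG_rrgD:
  assumes "weak_NG_rrg n" "cube n V" "{r1, r2} \<subseteq> cls V k" "{g, s, a, b} \<subseteq> cls V (\<not> k)"
     "r1 \<noteq> r2" "distinct [g, s, a, b]"
  obtains p where "p \<in> cls V k" "p \<notin> {r1, r2, x1, x2}" "two_paths (V - {r1, r2, g}) p s a b"
  using assms unfolding weak_NG_rrg_def by meson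

lemma GG_rrrgD: "GG_rrrg n \<Longrightarrow> cube n V \<Longrightarrow> {r1, r2, r3} \<subseteq> cls V k \<Longrightarrow> {g, a, b, c, d} \<subseteq> cls V (\<not> k) \<Longrightarrow>
     distinct [r1, r2, r3] \<Longrightarrow> distinct [g, a, b, c, d] \<Longrightarrow> two_paths (V - {r1, r2, r3, g}) a b c d"
  unfolding GG_rrrg_def by blast

text \<open>Two neutral paths, from \<open>p\<close> to \<open>y\<close> and from \<open>x\<close>
  to \<open>s\<close>, are merged along an edge between \<open>y\<close> and
  \<open>x\<close>.\<close>

lemma N_rg:
  assumes "NN_rg n" "4 \<le> n" "cube n V" "{r, p} \<subseteq> cls V k" "{g, s} \<subseteq> cls V (\<not> k)" "r \<noteq> p" "g \<noteq> s"
  shows "spans p s (V - {r, g})"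
proof -
  obtain y where y: "y \<in> V" "red y = (\<not> k)" "y \<notin> set [g, s]"
    by (rule pick_vertex[OF assms(3,2), of "[g, s]" "\<not> k"]) auto
  obtain x where x: "x \<in> V" "adjacent y x" "red x = (\<not> red y)" "x \<notin> set [r, p]"
    by (rule pick_neighbour[OF assms(3) y(1), of "[r, p]"]) (use assms(2) in auto)
  have "two_paths (V - {r, g}) p y x s"
    by (rule NN_rgD[OF assms(1,3), of _ _ _ k]) (use assms x y in auto)
  then show ?thesis using two_paths_join x(2) by blast
qed

text \<open>The end \<open>a\<close> is deleted as well and takes the part of \<open>g\<close> in
  \<open>NN_rg\<close>; a neighbour \<open>u\<close> replaces it as an end.\<close>

lemma NG_r:
  assumes "NN_rg n" "4 \<le> n" "cube n V" "{r, p} \<subseteq> cls V k" "{s, a, b} \<subseteq> cls V (\<not> k)" "r \<noteq> p" "distinct [s, a, b]"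
  shows "two_paths (V - {r}) p s a b"
proof -
  have aV: "a \<in> V" using assms by auto
  obtain u where u: "u \<in> V" "adjacent a u" "red u = (\<not> red a)" "u \<notin> set [r, p]"
    by (rule pick_neighbour[OF assms(3) aV, of "[r, p]"]) (use assms(2) in auto)
  have "two_paths (V - {r, a}) u b p s"
    by (rule NN_rgD[OF assms(1,3), of _ _ _ k]) (use assms u in auto)
  from two_paths_extend[OF this u(2)] have "two_paths (insert a (V - {r, a})) a b p s" by auto
  also have "insert a (V - {r, a}) = V - {r}" using assms by auto
  finally show ?thesis by (rule two_paths_swap)
qed

lemma G_r:
  assumes "NN_rg n" "4 \<le> n" "cube n V" "r \<in> cls V k" "{a, b} \<subseteq> cls V (\<not> k)" "a \<noteq> b"
  shows "spans a b (V - {r})"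
proof -
  obtain y where y: "y \<in> V" "red y = (\<not> k)" "y \<notin> set [a, b]"
    by (rule pick_vertex[OF assms(3,2), of "[a, b]" "\<not> k"]) auto
  obtain x where x: "x \<in> V" "adjacent y x" "red x = (\<not> red y)" "x \<notin> set [r]"
    by (rule pick_neighbour[OF assms(3) y(1), of "[r]"]) (use assms(2) in auto)
  have "two_paths (V - {r}) x a y b"
    by (rule NG_r[OF assms(1,2,3), of _ _ k]) (use assms x y in auto)
  then have "two_paths (V - {r}) a x y b" by (rule two_paths_rev)
  then show ?thesis using two_paths_join x(2) adjacent_sym by blast
qed

text \<open>
  Fewer deleted vertices are an easier task: delete an end of a path as well and prescribe a free
  neighbour as the new end.
\<close>

lemma NG_rrg_of_GG_rrrg:
  assumes "GG_rrrg n" "5 \<le> n" shows "NG_rrg n"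
  unfolding NG_rrg_def
proof (intro allI impI)
  fix V k r1 r2 g p s a b
  assume H: "cube n V" "{r1, r2, p} \<subseteq> cls V k" "{g, s, a, b} \<subseteq> cls V (\<not> k)" "distinct [r1, r2, p]" "distinct [g, s, a, b]"
  then have pV: "p \<in> V" by auto
  \<comment> \<open>Four vertices have to be avoided, which takes five neighbours. This is why
    dimension 4 is excluded here.\<close>
  obtain u where u: "u \<in> V" "adjacent p u" "red u = (\<not> red p)" "u \<notin> set [g, s, a, b]"
    by (rule pick_neighbour[OF H(1) pV, of "[g, s, a, b]"]) (use assms(2) in auto)
  have "two_paths (V - {r1, r2, p, g}) u s a b"
    by (rule GG_rrrgD[OF assms(1) H(1), of _ _ _ k]) (use H u in auto)
  from two_paths_extend[OF this u(2)] have "two_paths (insert p (V - {r1, r2, p, g})) p s a b" by auto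
  also have "insert p (V - {r1, r2, p, g}) = V - {r1, r2, g}" using H by auto
  finally show "two_paths (V - {r1, r2, g}) p s a b" .
qed

lemma NN_rg_of_NG_rrg:
  assumes "NG_rrg n" "4 \<le> n" shows "NN_rg n"
  unfolding NN_rg_def
proof (intro allI impI)
  fix V k r g p q s t
  assume H: "cube n V" "{r, p, q} \<subseteq> cls V k" "{g, s, t} \<subseteq> cls V (\<not> k)" "distinct [r, p, q]" "distinct [g, s, t]"
  then have pV: "p \<in> V" by auto
  obtain u where u: "u \<in> V" "adjacent p u" "red u = (\<not> red p)" "u \<notin> set [g, s, t]"
    by (rule pick_neighbour[OF H(1) pV, of "[g, s, t]"]) (use assms(2) in auto)
  have "two_paths (V - {r, p, g}) q t u s"
    by (rule NG_rrgD[OF assms(1) H(1), of _ _ _ k]) (use H u in auto)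
  from two_paths_extend[OF two_paths_swap[OF this] u(2)]
  have "two_paths (insert p (V - {r, p, g})) p s q t" by auto
  also have "insert p (V - {r, p, g}) = V - {r, g}" using H by auto
  finally show "two_paths (V - {r, g}) p s q t" .
qed

lemma GG_rr_of_NG_rrg:
  assumes "NG_rrg n" "4 \<le> n" shows "GG_rr n"
  unfolding GG_rr_def
proof (intro allI impI)
  fix V k r1 r2 a b c d
  assume H: "cube n V" "{r1, r2} \<subseteq> cls V k" "{a, b, c, d} \<subseteq> cls V (\<not> k)" "r1 \<noteq> r2" "distinct [a, b, c, d]"
  then have aV: "a \<in> V" by auto
  obtain u where u: "u \<in> V" "adjacent a u" "red u = (\<not> red a)" "u \<notin> set [r1, r2]"
    by (rule pick_neighbour[OF H(1) aV, of "[r1, r2]"]) (use assms(2) in auto)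
  have "two_paths (V - {r1, r2, a}) u b c d"
    by (rule NG_rrgD[OF assms(1) H(1), of _ _ _ k]) (use H u in auto)
  from two_paths_extend[OF this u(2)] have "two_paths (insert a (V - {r1, r2, a})) a b c d" by auto
  also have "insert a (V - {r1, r2, a}) = V - {r1, r2}" using H by auto
  finally show "two_paths (V - {r1, r2}) a b c d" .
qed

lemma G_rrg_of_NG_rrg:
  assumes "NG_rrg n" "4 \<le> n" shows "G_rrg n"
  unfolding G_rrg_def
proof (intro allI impI)
  fix V k r1 r2 g a b
  assume H: "cube n V" "{r1, r2} \<subseteq> cls V k" "{g, a, b} \<subseteq> cls V (\<not> k)" "r1 \<noteq> r2" "distinct [g, a, b]"
  obtain y where y: "y \<in> V" "red y = (\<not> k)" "y \<notin> set [g, a, b]"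
    by (rule pick_vertex[OF H(1) assms(2), of "[g, a, b]" "\<not> k"]) auto
  obtain x where x: "x \<in> V" "adjacent y x" "red x = (\<not> red y)" "x \<notin> set [r1, r2]"
    by (rule pick_neighbour[OF H(1) y(1), of "[r1, r2]"]) (use assms(2) in auto)
  have "two_paths (V - {r1, r2, g}) x a y b"
    by (rule NG_rrgD[OF assms(1) H(1), of _ _ _ k]) (use H x y in auto)
  then show "spans a b (V - {r1, r2, g})"
    using two_paths_join[OF two_paths_rev adjacent_sym] x(2) by blast
qed

lemma weak_NG_rrg_of_NG_rrg:
  assumes "NG_rrg n" "4 \<le> n" shows "weak_NG_rrg n"
  unfolding weak_NG_rrg_def
proof (intro allI impI)
  fix V k r1 r2 g s a b x1 x2
  assume H: "cube n V" "{r1, r2} \<subseteq> cls V k" "{g, s, a, b} \<subseteq> cls V (\<not> k)" "r1 \<noteq> r2" "distinct [g, s, a, b]"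
  obtain p where p: "p \<in> V" "red p = k" "p \<notin> set [r1, r2, x1, x2]"
    by (rule pick_vertex[OF H(1) assms(2), of "[r1, r2, x1, x2]" k]) auto
  have "two_paths (V - {r1, r2, g}) p s a b"
    by (rule NG_rrgD[OF assms(1) H(1), of _ _ _ k]) (use H p in auto)
  then show "\<exists>p \<in> cls V k. p \<notin> {r1, r2, x1, x2} \<and> two_paths (V - {r1, r2, g}) p s a b"
    using p by auto
qed

section \<open>Splitting off one deleted vertex of each colour\<close>

text \<open>What the halves have to provide. In contrast to \<open>NG_rrg\<close>, all of this
  already holds in dimension 4.\<close>

definition cube_facts :: "nat \<Rightarrow> bool" where
  "cube_facts n \<longleftrightarrow> 4 \<le> n \<and> NN_rg n \<and> GG_rr n \<and> G_rrg n \<and> weak_NG_rrg n"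

text \<open>The reflection \<open>f\<close> across the split is abstract and treats both sides
  alike, so that \<open>A\<close> can be either side of a coordinate.\<close>

locale halves =
  fixes n :: nat and A B :: "bool list set" and f :: "bool list \<Rightarrow> bool list"
  assumes facts: "cube_facts n"
    and cubes: "cube n A" "cube n B" and disj: "A \<inter> B = {}"
    and f_A: "x \<in> A \<Longrightarrow> f x \<in> B" and f_B: "x \<in> B \<Longrightarrow> f x \<in> A"
    and f_f [simp]: "f (f x) = x"
    and f_adj: "x \<in> A \<union> B \<Longrightarrow> adjacent x (f x)"
begin

lemma dim: "4 \<le> n" and NN: "NN_rg n" and GG: "GG_rr n" and G: "G_rrg n" and NGw: "weak_NG_rrg n"
  using facts by (auto simp: cube_facts_def)

lemma f_red: "x \<in> A \<union> B \<Longrightarrow> red (f x) = (\<not> red x)"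
  using f_adj adjacent_red by blast

lemma f_eq: "f x = y \<longleftrightarrow> x = f y"
  using f_f by metis

lemma f_inj [simp]: "f x = f y \<longleftrightarrow> x = y"
  using f_f by metis

lemma red_A: "x \<in> A \<Longrightarrow> red (f x) = (\<not> red x)" and red_B: "x \<in> B \<Longrightarrow> red (f x) = (\<not> red x)"
  using f_red by auto

lemma adj_A: "x \<in> A \<Longrightarrow> adjacent x (f x)" and adj_B: "x \<in> B \<Longrightarrow> adjacent x (f x)"
  using f_adj by auto

end

text \<open>
  A decomposition of \<open>W\<close> into paths that start at the given vertices and end in colour \<open>k\<close>. Cutting
  a path in front of an inner vertex \<open>d\<close> of the other colour yields a further path of this kind.
\<close>

inductive strands :: "bool \<Rightarrow> bool list set \<Rightarrow> bool list list \<Rightarrow> bool" for k where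
  nil: "strands k {} []"
| cons: "spans t e S \<Longrightarrow> red e = k \<Longrightarrow> strands k W ts \<Longrightarrow> S \<inter> W = {} \<Longrightarrow> strands k (S \<union> W) (t # ts)"

inductive_cases strands_nilE: "strands k W []"
inductive_cases strands_consE: "strands k W (t # ts)"

lemma strands_swap: "strands k W (s # t # ts) \<Longrightarrow> strands k W (t # s # ts)"
proof -
  assume "strands k W (s # t # ts)"
  then obtain e S e' S' U where *: "spans s e S" "red e = k" "spans t e' S'" "red e' = k" "strands k U ts"
    "S' \<inter> U = {}" "S \<inter> (S' \<union> U) = {}" "W = S \<union> (S' \<union> U)"
    by (auto elim!: strands_consE)
  then have "strands k (S' \<union> (S \<union> U)) (t # s # ts)"
    by (intro strands.cons[OF *(3,4) strands.cons[OF *(1,2,5)]]) auto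
  also have "S' \<union> (S \<union> U) = W" using * by auto
  finally show ?thesis .
qed

lemma strands_insert:
  assumes "strands k W ts" "d \<in> W" "d \<notin> set ts" "red d \<noteq> k"
  shows "strands k W (d # ts)"
  using assms
proof (induction rule: strands.induct)
  case (cons t e S W ts)
  show ?case
  proof (cases "d \<in> S")
    case True
    obtain z S1 S2 where z: "spans t z S1" "spans d e S2" "adjacent z d" "S1 \<inter> S2 = {}" "S = S1 \<union> S2"
      using spans_cut[OF cons.hyps(1) True] cons.prems by auto
    have "red z = k" using adjacent_red[OF z(3)] cons.prems by auto
    then have "strands k (S2 \<union> (S1 \<union> W)) (d # t # ts)"
      using z cons.hyps by (intro strands.cons[OF z(2) _ strands.cons[OF z(1)]]) auto
    also have "S2 \<union> (S1 \<union> W) = S \<union> W" using z by auto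
    finally show ?thesis .
  next
    case False
    then have "strands k W (d # ts)" using cons by auto
    then have "strands k (S \<union> W) (t # d # ts)" using cons.hyps by (intro strands.cons[OF cons.hyps(1,2)])
    then show ?thesis by (rule strands_swap)
  qed
qed auto

section \<open>Two vertices of colour \<open>k\<close> deleted in \<open>A\<close>, one of each
  colour deleted in \<open>B\<close>\<close>

locale split22 = halves +
  fixes k :: bool and r1 r2 r3 g :: "bool list"
  assumes rA: "r1 \<in> cls A k" "r2 \<in> cls A k" "r1 \<noteq> r2" and rB: "r3 \<in> cls B k" and gB: "g \<in> cls B (\<not> k)"
begin

definition "WA = A - {r1, r2}"
definition "WB = B - {r3, g}"

lemma W_disj: "WA \<inter> WB = {}"
  using disj by (auto simp: WA_def WB_def)

lemma GG_A: "{a, b, c, d} \<subseteq> cls A (\<not> k) \<Longrightarrow> distinct [a, b, c, d] \<Longrightarrow> two_paths WA a b c d"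
  unfolding WA_def using rA by (intro GG_rrD[OF GG cubes(1), of _ _ k]) auto

lemma NN_B: "{p, q} \<subseteq> cls B k \<Longrightarrow> {s, t} \<subseteq> cls B (\<not> k) \<Longrightarrow> distinct [r3, p, q] \<Longrightarrow> distinct [g, s, t] \<Longrightarrow>
    two_paths WB p s q t"
  unfolding WB_def using rB gB by (intro NN_rgD[OF NN cubes(2), of _ _ _ k]) auto

lemma N_B: "p \<in> cls B k \<Longrightarrow> s \<in> cls B (\<not> k) \<Longrightarrow> r3 \<noteq> p \<Longrightarrow> g \<noteq> s \<Longrightarrow> spans p s WB"
  unfolding WB_def using rB gB by (intro N_rg[OF NN dim cubes(2), of _ _ k]) auto

lemma cross_both:
  assumes "{a, c} \<subseteq> cls A (\<not> k)" "{b, d} \<subseteq> cls B (\<not> k)" "a \<noteq> c" "distinct [g, b, d]"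
  shows "two_paths (WA \<union> WB) a b c d"
proof -
  \<comment> \<open>The crossing edge must not lead to a deleted vertex. \<open>f x\<close> has
    colour \<open>k\<close>, so that only \<open>r3\<close> can be hit.\<close>
  obtain x where x: "x \<in> A" "red x = (\<not> k)" "x \<notin> set [a, c, f r3]"
    by (rule pick_vertex[OF cubes(1) dim, of "[a, c, f r3]" "\<not> k"]) auto
  obtain y where y: "y \<in> A" "red y = (\<not> k)" "y \<notin> set [a, c, f r3, x]"
    by (rule pick_vertex[OF cubes(1) dim, of "[a, c, f r3, x]" "\<not> k"]) auto
  have "two_paths WA a x c y"
    by (rule GG_A) (use assms x y in auto)
  moreover have "two_paths WB (f x) b (f y) d"
    by (rule NN_B) (use assms x y in \<open>auto simp: red_A f_A f_eq\<close>)
  ultimately show ?thesis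
    by (rule two_paths_cross2) (use adj_A x y W_disj in auto)
qed

lemma cross_one_A:
  assumes "{a, c, d} \<subseteq> cls A (\<not> k)" "b \<in> cls B (\<not> k)" "distinct [a, c, d]" "g \<noteq> b"
  shows "two_paths (WA \<union> WB) a b c d"
proof -
  obtain x where x: "x \<in> A" "red x = (\<not> k)" "x \<notin> set [a, c, d, f r3]"
    by (rule pick_vertex[OF cubes(1) dim, of "[a, c, d, f r3]" "\<not> k"]) auto
  have "two_paths WA a x c d"
    by (rule GG_A) (use assms x in auto)
  moreover have "spans (f x) b WB"
    by (rule N_B) (use assms x in \<open>auto simp: red_A f_A f_eq\<close>)
  ultimately show ?thesis
    by (rule two_paths_cross1) (use adj_A x W_disj in auto)
qed

text \<open>\<open>WA\<close> has two vertices more of colour \<open>\<not> k\<close> than of colour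
  \<open>k\<close>, hence no single path from \<open>a\<close> to \<open>b\<close> covers it. The
  path from \<open>c\<close> to \<open>d\<close> has to make a detour through
  \<open>A\<close>.\<close>

lemma separate:
  assumes "{a, b} \<subseteq> cls A (\<not> k)" "{c, d} \<subseteq> cls B (\<not> k)" "a \<noteq> b" "distinct [g, c, d]"
  shows "two_paths (WA \<union> WB) a b c d"
proof -
  obtain y where y: "y \<in> B" "red y = k" "y \<notin> set [r3, f a, f b]"
    by (rule pick_vertex[OF cubes(2) dim, of "[r3, f a, f b]" k]) auto
  obtain w where w: "w \<in> B" "red w = k" "w \<notin> set [r3, f a, f b, y]"
    by (rule pick_vertex[OF cubes(2) dim, of "[r3, f a, f b, y]" k]) auto
  have "two_paths WB y c w d"
    by (rule NN_B) (use assms y w in auto)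
  then have "two_paths WB c y d w"
    using two_paths_rev two_paths_rev2 by blast
  moreover have "two_paths WA a b (f y) (f w)"
    by (rule GG_A) (use assms y w in \<open>auto simp: red_B f_B f_eq\<close>)
  ultimately show ?thesis
    using adj_B y w W_disj by (intro two_paths_detour[of WA a b "f y" "f w" WB]) auto
qed

text \<open>
  The first edge \<open>a\<close>-\<open>z\<close> is replaced by a detour through \<open>B\<close> from \<open>f a\<close> to \<open>f z\<close>, and the last two
  assumptions ensure that these are not deleted.
\<close>

lemma all_A_aux:
  assumes "{a, b, c, d} \<subseteq> cls A (\<not> k)" "distinct [a, b, c, d]"
    and S: "spans a b S" "spans c d T" "S \<inter> T = {}" "S \<union> T = WA" "f g \<notin> S" "f a \<noteq> r3"
  shows "two_paths (WA \<union> WB) a b c d"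
proof -
  obtain z S' where z: "adjacent a z" "spans z b S'" "a \<notin> S'" "S = insert a S'"
    using S(1) assms(2) by (auto elim: spans_first)
  have zS: "z \<in> S'" using z(2) spans_ends by blast
  then have zA: "z \<in> A" "z \<noteq> f g" using S z by (auto simp: WA_def)
  have "red z = k" using adjacent_red[OF z(1)] assms by auto
  have fz: "spans (f a) (f z) WB"
    by (rule N_B) (use assms zA \<open>red z = k\<close> in \<open>auto simp: red_A f_A f_eq\<close>)
  have "{a} \<inter> WB = {}" "{a} \<inter> S' = {}" "WB \<inter> S' = {}" "adjacent a (f a)" "adjacent z (f z)"
    using z S(4) W_disj adj_A assms(1) zA by auto
  then have "spans a b ({a} \<union> WB \<union> S')"
    by (intro spans_join3[OF spans.single fz z(2)])
  then show ?thesis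
    by (rule two_pathsI[OF _ S(2)]) (use z(4) S(3,4) W_disj in auto)
qed

text \<open>Of the two paths that cover \<open>WA\<close>, one misses \<open>f g\<close>, and at
  most one of its ends is opposite to \<open>r3\<close>. The detour starts at the other end.\<close>

lemma all_A:
  assumes "{a, b, c, d} \<subseteq> cls A (\<not> k)" "distinct [a, b, c, d]"
  shows "two_paths (WA \<union> WB) a b c d"
proof -
  have "two_paths WA a b c d"
    by (rule GG_A) (use assms in auto)
  then obtain S T where S: "spans a b S" "spans c d T" "S \<inter> T = {}" "S \<union> T = WA"
    by (rule two_pathsE)
  have neq: "f a \<noteq> r3 \<or> f b \<noteq> r3" "f c \<noteq> r3 \<or> f d \<noteq> r3"
    using assms by (metis distinct_length_2_or_more f_f)+
  have sets: "{b, a, c, d} \<subseteq> cls A (\<not> k)" "{c, d, a, b} \<subseteq> cls A (\<not> k)" "{d, c, a, b} \<subseteq> cls A (\<not> k)"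
    and dist: "distinct [b, a, c, d]" "distinct [c, d, a, b]" "distinct [d, c, a, b]"
    and TS: "T \<inter> S = {}" "T \<union> S = WA"
    using assms S by auto
  show ?thesis
  proof (cases "f g \<in> S")
    case False
    then show ?thesis
      using neq(1) all_A_aux[OF assms S] all_A_aux[OF sets(1) dist(1) spans_sym[OF S(1)] S(2-4)] two_paths_rev
      by blast
  next
    case True
    then have "f g \<notin> T" using S by auto
    then have "two_paths (WA \<union> WB) c d a b \<or> two_paths (WA \<union> WB) d c a b"
      using neq(2) all_A_aux[OF sets(2) dist(2) S(2,1) TS]
        all_A_aux[OF sets(3) dist(3) spans_sym[OF S(2)] S(1) TS] by blast
    then show ?thesis using two_paths_swap two_paths_rev by blast
  qed
qed

text \<open>\<open>WB\<close> is cut into four strands that start at \<open>a\<close>,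
  \<open>b\<close>, \<open>c\<close>, \<open>d\<close>. However the cuts turn out, the strands end
  in colour \<open>k\<close>, so that their ends can be continued in \<open>A\<close>, where
  \<open>GG_A\<close> links them in the required way.\<close>

lemma all_B:
  assumes "{a, b, c, d} \<subseteq> cls B (\<not> k)" "distinct [g, a, b, c, d]"
  shows "two_paths (WA \<union> WB) a b c d"
proof -
  obtain x where x: "x \<in> B" "red x = k" "x \<notin> set [r3]"
    by (rule pick_vertex[OF cubes(2) dim, of "[r3]" k]) auto
  obtain y where y: "y \<in> B" "red y = k" "y \<notin> set [r3, x]"
    by (rule pick_vertex[OF cubes(2) dim, of "[r3, x]" k]) auto
  have "two_paths WB x a y c"
    by (rule NN_B) (use assms x y in auto)
  then obtain S T where ST: "spans x a S" "spans y c T" "S \<inter> T = {}" "S \<union> T = WB"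
    by (rule two_pathsE)
  have "strands k (S \<union> (T \<union> {})) [a, c]"
    by (rule strands.cons[OF spans_sym[OF ST(1)] _ strands.cons[OF spans_sym[OF ST(2)] _ strands.nil]])
      (use ST(3) x y in auto)
  then have "strands k WB [a, c]" using ST(4) by simp
  then have "strands k WB [b, a, c]"
    by (rule strands_insert) (use assms rB gB in \<open>auto simp: WB_def\<close>)
  then have "strands k WB [d, b, a, c]"
    by (rule strands_insert) (use assms rB gB in \<open>auto simp: WB_def\<close>)
  then obtain ed Sd U1 where d: "spans d ed Sd" "red ed = k" "strands k U1 [b, a, c]" "Sd \<inter> U1 = {}" "WB = Sd \<union> U1"
    by (rule strands_consE)
  from d(3) obtain eb Sb U2 where b: "spans b eb Sb" "red eb = k" "strands k U2 [a, c]" "Sb \<inter> U2 = {}" "U1 = Sb \<union> U2"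
    by (rule strands_consE)
  from b(3) obtain ea Sa U3 where a: "spans a ea Sa" "red ea = k" "strands k U3 [c]" "Sa \<inter> U3 = {}" "U2 = Sa \<union> U3"
    by (rule strands_consE)
  from a(3) obtain ec Sc U4 where c: "spans c ec Sc" "red ec = k" "strands k U4 []" "Sc \<inter> U4 = {}" "U3 = Sc \<union> U4"
    by (rule strands_consE)
  have "U4 = {}" using c(3) by (rule strands_nilE)
  note e = a(1) b(1) c(1) d(1) a(2) b(2) c(2) d(2)
  have e_WB: "WB = Sd \<union> (Sb \<union> (Sa \<union> Sc))"
    and e_disj: "Sd \<inter> (Sb \<union> (Sa \<union> Sc)) = {}" "Sb \<inter> (Sa \<union> Sc) = {}" "Sa \<inter> Sc = {}"
    using a b c d \<open>U4 = {}\<close> by simp_all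
  have in_B: "{ea, eb, ec, ed} \<subseteq> B" "distinct [ea, eb, ec, ed]"
    using e_WB e_disj spans_ends[OF e(1)] spans_ends[OF e(2)] spans_ends[OF e(3)] spans_ends[OF e(4)]
    by (auto simp: WB_def)
  have "two_paths WA (f ea) (f eb) (f ec) (f ed)"
    by (rule GG_A) (use in_B e(5-8) in \<open>auto simp: red_B f_B\<close>)
  then obtain U U' where U: "spans (f ea) (f eb) U" "spans (f ec) (f ed) U'" "U \<inter> U' = {}" "U \<union> U' = WA"
    by (rule two_pathsE)
  have adj: "adjacent ea (f ea)" "adjacent eb (f eb)" "adjacent ec (f ec)" "adjacent ed (f ed)"
    using in_B adj_B by auto
  have "spans a b (Sa \<union> U \<union> Sb)"
    by (rule spans_join3[OF e(1) U(1) spans_sym[OF e(2)] adj(1,2)]) (use e_WB e_disj U(4) W_disj in blast)+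
  moreover have "spans c d (Sc \<union> U' \<union> Sd)"
    by (rule spans_join3[OF e(3) U(2) spans_sym[OF e(4)] adj(3,4)]) (use e_WB e_disj U(4) W_disj in blast)+
  ultimately show ?thesis
    by (rule two_pathsI) (use e_WB e_disj U(3,4) W_disj in blast)+
qed

text \<open>
  A cover by paths from \<open>a\<close> and \<open>c\<close> is cut before the inner vertex \<open>d\<close>. If the cut is at the
  neighbour \<open>f b\<close> of \<open>b\<close>, it cannot be continued in \<open>A\<close>; then \<open>a\<close> is linked to \<open>b\<close> directly,
  or the path is cut behind \<open>d\<close> instead.
\<close>

lemma cross_one_B:
  assumes "{a, c, d} \<subseteq> cls B (\<not> k)" "b \<in> cls A (\<not> k)" "distinct [g, a, c, d]"
  shows "two_paths (WA \<union> WB) a b c d"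
proof -
  obtain x where x: "x \<in> B" "red x = k" "x \<notin> set [r3, f b]"
    by (rule pick_vertex[OF cubes(2) dim, of "[r3, f b]" k]) auto
  have dB: "d \<in> B" using assms(1) by auto
  \<comment> \<open>\<open>y\<close> is not a neighbour of \<open>d\<close>: if the path is cut
    behind \<open>d\<close> below, the successor \<open>q\<close> of \<open>d\<close> must differ
    from \<open>y\<close>.\<close>
  obtain y where y: "y \<in> B" "red y = k" "\<not> adjacent d y" "y \<notin> set [r3, f b, x]"
    by (rule pick_nonneighbour[OF cubes(2) dim dB, of "[r3, f b, x]" k]) auto
  have "two_paths WB x a y c"
    by (rule NN_B) (use assms x y in auto)
  then obtain S T where ST: "spans x a S" "spans y c T" "S \<inter> T = {}" "S \<union> T = WB"
    by (rule two_pathsE)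
  note sa = spans_sym[OF ST(1)] and sc = spans_sym[OF ST(2)]
  have adj: "adjacent x (f x)" "adjacent y (f y)" using x y adj_B by auto
  have "f x \<noteq> b" "f y \<noteq> b" using x y f_eq by auto
  have cA: "f v \<in> cls A (\<not> k)" if "v \<in> B" "red v = k" for v
    using that f_B red_B by auto
  have "d \<in> S \<or> d \<in> T" using assms(1,3) rB gB ST(4) by (auto simp: WB_def)
  then show ?thesis
  proof
    assume "d \<in> T"
    with assms(3) obtain z T1 T2 where
      z: "spans c z T1" "spans d y T2" "adjacent z d" "T1 \<inter> T2 = {}" "T = T1 \<union> T2"
      by (auto elim: spans_cut[OF sc])
    have zT: "z \<in> T1" "y \<in> T2" "x \<in> S" using z spans_ends ST(1) by blast+
    have zB: "z \<in> B" "red z = k" "z \<noteq> x" "z \<noteq> y"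
      using zT z(4,5) ST(3,4) adjacent_red[OF z(3)] assms(1) by (auto simp: WB_def)
    show ?thesis
    proof (cases "f z = b")
      case False
      have "two_paths WA (f x) b (f z) (f y)"
        by (rule GG_A)
          (use assms(2) cA x y zB False \<open>f x \<noteq> b\<close> \<open>f y \<noteq> b\<close> in auto)
      then obtain U1 U2 where U: "spans (f x) b U1" "spans (f z) (f y) U2" "U1 \<inter> U2 = {}" "U1 \<union> U2 = WA"
        by (rule two_pathsE)
      have "spans a b (S \<union> U1)"
        by (rule spans_join[OF sa U(1) adj(1)]) (use ST(4) U(4) W_disj in blast)+
      moreover have "spans c d (T1 \<union> U2 \<union> T2)"
        by (rule spans_join3[OF z(1) U(2) spans_sym[OF z(2)] adj_B[OF zB(1)] adj(2)])
          (use ST(4) z(4,5) U(4) W_disj in blast)+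
      ultimately show ?thesis
        by (rule two_pathsI) (use ST(3,4) z(4,5) U(3,4) W_disj in blast)+
    next
      case True
      have "d \<noteq> y" using assms(1) y by auto
      then obtain q T3 where q: "adjacent d q" "spans q y T3" "d \<notin> T3" "T2 = insert d T3"
        using z(2) by (auto elim: spans_first)
      have "q \<in> T3" using q(2) spans_ends by blast
      then have qB: "q \<in> B" "red q = k" "q \<noteq> x" "q \<noteq> y" "q \<noteq> z"
        using q(1,4) z(4,5) zT ST(3,4) adjacent_red[OF q(1)] assms(1) y by (auto simp: WB_def)
      have "two_paths WA (f x) (f y) (f q) b"
        by (rule GG_A)
          (use assms(2) cA x y qB True \<open>f x \<noteq> b\<close> \<open>f y \<noteq> b\<close> in auto)
      then obtain U1 U2 where U: "spans (f x) (f y) U1" "spans (f q) b U2" "U1 \<inter> U2 = {}" "U1 \<union> U2 = WA"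
        by (rule two_pathsE)
      have "spans a q (S \<union> U1 \<union> T3)"
        by (rule spans_join3[OF sa U(1) spans_sym[OF q(2)] adj])
          (use ST(3,4) q(4) z(5) U(4) W_disj in blast)+
      then have "spans a b (S \<union> U1 \<union> T3 \<union> U2)"
        by (rule spans_join[OF _ U(2) adj_B[OF qB(1)]]) (use ST(3,4) q(4) z(5) U(3,4) W_disj in blast)+
      moreover have "spans c d (T1 \<union> {d})"
        by (rule spans_join[OF z(1) spans.single z(3)]) (use z(4) q(4) in blast)+
      ultimately show ?thesis
        by (rule two_pathsI) (use ST(3,4) z(4,5) q(3,4) U(3,4) W_disj in blast)+
    qed
  next
    assume "d \<in> S"
    with assms(3) obtain z S1 S2 where
      z: "spans a z S1" "spans d x S2" "adjacent z d" "S1 \<inter> S2 = {}" "S = S1 \<union> S2"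
      by (auto elim: spans_cut[OF sa])
    have zS: "z \<in> S1" "x \<in> S2" "y \<in> T" using z spans_ends ST(2) by blast+
    have zB: "z \<in> B" "red z = k" "z \<noteq> x" "z \<noteq> y"
      using zS z(4,5) ST(3,4) adjacent_red[OF z(3)] assms(1) by (auto simp: WB_def)
    show ?thesis
    proof (cases "f z = b")
      case False
      have "two_paths WA (f z) b (f y) (f x)"
        by (rule GG_A)
          (use assms(2) cA x y zB False \<open>f x \<noteq> b\<close> \<open>f y \<noteq> b\<close> in auto)
      then obtain U1 U2 where U: "spans (f z) b U1" "spans (f y) (f x) U2" "U1 \<inter> U2 = {}" "U1 \<union> U2 = WA"
        by (rule two_pathsE)
      have "spans a b (S1 \<union> U1)"
        by (rule spans_join[OF z(1) U(1) adj_B[OF zB(1)]]) (use ST(4) z(5) U(4) W_disj in blast)+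
      moreover have "spans c d (T \<union> U2 \<union> S2)"
        by (rule spans_join3[OF sc U(2) spans_sym[OF z(2)] adj(2,1)])
          (use ST(3,4) z(4,5) U(4) W_disj in blast)+
      ultimately show ?thesis
        by (rule two_pathsI) (use ST(3,4) z(4,5) U(3,4) W_disj in blast)+
    next
      case True
      \<comment> \<open>\<open>b\<close> is already reached from \<open>z\<close> and must be
        avoided by the detour; as a further deleted vertex it takes the part of \<open>g\<close> in
        \<open>G_rrg\<close>.\<close>
      have "spans (f y) (f x) (A - {r1, r2, b})"
        by (rule G_rrgD[OF G cubes(1), of _ _ k])
          (use assms(2) cA x y rA \<open>f x \<noteq> b\<close> \<open>f y \<noteq> b\<close> in auto)
      moreover have "A - {r1, r2, b} = WA - {b}" by (auto simp: WA_def)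
      ultimately have U: "spans (f y) (f x) (WA - {b})" by simp
      have bW: "b \<in> WA" using assms(2) rA by (auto simp: WA_def)
      have "spans a b (S1 \<union> {b})"
        by (rule spans_join[OF z(1) spans.single]) (use True adj_B[OF zB(1)] bW W_disj ST(4) z(5) in blast)+
      moreover have "spans c d (T \<union> (WA - {b}) \<union> S2)"
        by (rule spans_join3[OF sc U spans_sym[OF z(2)] adj(2,1)])
          (use ST(3,4) z(4,5) W_disj in blast)+
      ultimately show ?thesis
        by (rule two_pathsI) (use bW ST(3,4) z(4,5) W_disj in blast)+
    qed
  qed
qed

end

text \<open>Reversing and exchanging the paths reduces the 16 distributions of the ends over both
  sides to six. The last one is assumed for the given ends only, because \<open>split31\<close> can
  handle it only under conditions on \<open>d\<close>.\<close>

lemma two_paths_by_sides: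
  assumes all_A: "\<And>a b c d. {a, b, c, d} \<subseteq> cls A k \<Longrightarrow> distinct [g, a, b, c, d] \<Longrightarrow> two_paths W a b c d"
    and cross_one_A: "\<And>a b c d. {a, c, d} \<subseteq> cls A k \<Longrightarrow> b \<in> cls B k \<Longrightarrow> distinct [g, a, b, c, d] \<Longrightarrow> two_paths W a b c d"
    and cross_both: "\<And>a b c d. {a, c} \<subseteq> cls A k \<Longrightarrow> {b, d} \<subseteq> cls B k \<Longrightarrow> distinct [g, a, b, c, d] \<Longrightarrow> two_paths W a b c d"
    and separate: "\<And>a b c d. {a, b} \<subseteq> cls A k \<Longrightarrow> {c, d} \<subseteq> cls B k \<Longrightarrow> distinct [g, a, b, c, d] \<Longrightarrow> two_paths W a b c d"
    and cross_one_B: "\<And>a b c d. a \<in> cls A k \<Longrightarrow> {b, c, d} \<subseteq> cls B k \<Longrightarrow> distinct [g, a, b, c, d] \<Longrightarrow> two_paths W a b c d"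
    and all_B: "{a, b, c, d} \<subseteq> cls B k \<Longrightarrow> two_paths W a b c d"
    and abcd: "{a, b, c, d} \<subseteq> cls (A \<union> B) k" "distinct [g, a, b, c, d]"
  shows "two_paths W a b c d"
proof -
  have first_A: "two_paths W a b c d"
    if "{a, b, c, d} \<subseteq> cls (A \<union> B) k" "distinct [g, a, b, c, d]" "a \<in> A" for a b c d
  proof (cases "b \<in> A")
    case True
    show ?thesis
    proof (cases "c \<in> A"; cases "d \<in> A")
      assume "c \<in> A" "d \<in> A"
      then show ?thesis using that True by (intro all_A) auto
    next
      assume "c \<in> A" "d \<notin> A"
      then show ?thesis using that True by (intro two_paths_swap[OF cross_one_A]) auto
    next
      assume "c \<notin> A" "d \<in> A"
      then show ?thesis using that True by (intro two_paths_rev2[OF two_paths_swap[OF cross_one_A]]) auto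
    next
      assume "c \<notin> A" "d \<notin> A"
      then show ?thesis using that True by (intro separate) auto
    qed
  next
    case False
    show ?thesis
    proof (cases "c \<in> A"; cases "d \<in> A")
      assume "c \<in> A" "d \<in> A"
      then show ?thesis using that False by (intro cross_one_A) auto
    next
      assume "c \<in> A" "d \<notin> A"
      then show ?thesis using that False by (intro cross_both) auto
    next
      assume "c \<notin> A" "d \<in> A"
      then show ?thesis using that False by (intro two_paths_rev2[OF cross_both]) auto
    next
      assume "c \<notin> A" "d \<notin> A"
      then show ?thesis using that False by (intro cross_one_B) auto
    qed
  qed
  have perms: "{b, a, c, d} \<subseteq> cls (A \<union> B) k" "distinct [g, b, a, c, d]"
    "{c, d, a, b} \<subseteq> cls (A \<union> B) k" "distinct [g, c, d, a, b]"
    "{d, c, a, b} \<subseteq> cls (A \<union> B) k" "distinct [g, d, c, a, b]"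
    using abcd by auto
  consider "a \<in> A" | "b \<in> A" | "c \<in> A" | "d \<in> A" | "{a, b, c, d} \<inter> A = {}" by blast
  then show ?thesis
  proof cases
    case 1 show ?thesis by (rule first_A[OF abcd 1])
  next
    case 2 show ?thesis by (rule two_paths_rev[OF first_A[OF perms(1,2) 2]])
  next
    case 3 show ?thesis by (rule two_paths_swap[OF first_A[OF perms(3,4) 3]])
  next
    case 4 show ?thesis by (rule two_paths_swap[OF two_paths_rev[OF first_A[OF perms(5,6) 4]]])
  next
    case 5 then show ?thesis using abcd by (intro all_B) auto
  qed
qed

lemma (in split22) split22_cover:
  assumes "{a, b, c, d} \<subseteq> cls (A \<union> B) (\<not> k)" "distinct [g, a, b, c, d]"
  shows "two_paths (A \<union> B - {r1, r2, r3, g}) a b c d"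
proof -
  have "two_paths (WA \<union> WB) a b c d"
  proof (rule two_paths_by_sides[OF _ _ _ _ _ _ assms])
    show "two_paths (WA \<union> WB) a b c d" if "{a, b, c, d} \<subseteq> cls A (\<not> k)" "distinct [g, a, b, c, d]" for a b c d
      using that by (intro all_A) auto
    show "two_paths (WA \<union> WB) a b c d"
      if "{a, c, d} \<subseteq> cls A (\<not> k)" "b \<in> cls B (\<not> k)" "distinct [g, a, b, c, d]" for a b c d
      using that by (intro cross_one_A) auto
    show "two_paths (WA \<union> WB) a b c d"
      if "{a, c} \<subseteq> cls A (\<not> k)" "{b, d} \<subseteq> cls B (\<not> k)" "distinct [g, a, b, c, d]" for a b c d
      using that by (intro cross_both) auto
    show "two_paths (WA \<union> WB) a b c d"
      if "{a, b} \<subseteq> cls A (\<not> k)" "{c, d} \<subseteq> cls B (\<not> k)" "distinct [g, a, b, c, d]" for a b c d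
      using that by (intro separate) auto
    show "two_paths (WA \<union> WB) a b c d"
      if "a \<in> cls A (\<not> k)" "{b, c, d} \<subseteq> cls B (\<not> k)" "distinct [g, a, b, c, d]" for a b c d
      using that by (intro two_paths_rev[OF cross_one_B]) auto
    show "two_paths (WA \<union> WB) a b c d" if "{a, b, c, d} \<subseteq> cls B (\<not> k)"
      using that assms by (intro all_B) auto
  qed
  moreover have "WA \<union> WB = A \<union> B - {r1, r2, r3, g}"
    using rA rB gB disj by (auto simp: WA_def WB_def)
  ultimately show ?thesis by simp
qed

text \<open>
  If \<open>d\<close> is inside the path from \<open>c\<close>, the segment up to \<open>d\<close> is linked to the other one via \<open>W2\<close>. If
  \<open>d\<close> is inside the path from \<open>a\<close> to \<open>b\<close>, it is taken out of this path, which is repaired via \<open>W2\<close>.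
\<close>

lemma reroute_inner:
  assumes P: "two_paths W1 y c a b" and d: "d \<in> W1" "d \<notin> {y, c, a, b}" and disj: "W1 \<inter> W2 = {}"
    and adj: "\<And>v. v \<in> W1 \<Longrightarrow> adjacent v (f v)"
    and one: "\<And>z. z \<in> W1 \<Longrightarrow> adjacent z d \<Longrightarrow> z \<noteq> y \<Longrightarrow> spans (f z) (f y) W2"
    and two: "\<And>z w. {z, w} \<subseteq> W1 \<Longrightarrow> adjacent z d \<Longrightarrow> adjacent w d \<Longrightarrow> distinct [y, z, w] \<Longrightarrow>
      two_paths W2 (f d) (f y) (f z) (f w)"
  shows "two_paths (W1 \<union> W2) a b c d"
proof -
  obtain S T where ST: "spans y c S" "spans a b T" "S \<inter> T = {}" "S \<union> T = W1"
    using P by (rule two_pathsE)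
  note sc = spans_sym[OF ST(1)]
  have yS: "y \<in> S" using ST(1) spans_ends by blast
  have "d \<in> S \<or> d \<in> T" using d ST(4) by auto
  then show ?thesis
  proof
    assume "d \<in> S"
    with d obtain z S1 S2 where
      z: "spans c z S1" "spans d y S2" "adjacent z d" "S1 \<inter> S2 = {}" "S = S1 \<union> S2"
      by (auto elim: spans_cut[OF sc])
    have zS: "z \<in> S1" "y \<in> S2" using z spans_ends by blast+
    then have zW: "z \<in> W1" "y \<in> W1" "z \<noteq> y" using z(4,5) ST(4) by auto
    have "spans c d (S1 \<union> W2 \<union> S2)"
      by (rule spans_join3[OF z(1) one[OF zW(1) z(3) zW(3)] spans_sym[OF z(2)] adj[OF zW(1)] adj[OF zW(2)]])
        (use ST(4) z(4,5) disj in blast)+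
    then show ?thesis
      by (rule two_pathsI[OF ST(2)]) (use ST(3,4) z(5) disj in blast)+
  next
    assume "d \<in> T"
    with d obtain z T1 T2 where
      z: "spans a z T1" "spans d b T2" "adjacent z d" "T1 \<inter> T2 = {}" "T = T1 \<union> T2"
      by (auto elim: spans_cut[OF ST(2)])
    have "d \<noteq> b" using d by auto
    then obtain w T3 where w: "adjacent d w" "spans w b T3" "d \<notin> T3" "T2 = insert d T3"
      using z(2) by (auto elim: spans_first)
    have zT: "z \<in> T1" "w \<in> T3" using z w spans_ends by blast+
    have zW: "z \<in> W1" "w \<in> W1" "y \<in> W1" "d \<in> W1" "distinct [y, z, w]"
      using zT yS z(4,5) w(4) ST(3,4) d by auto
    then have "two_paths W2 (f d) (f y) (f z) (f w)"
      using z(3) adjacent_sym[OF w(1)] by (intro two) auto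
    then obtain U1 U2 where U: "spans (f d) (f y) U1" "spans (f z) (f w) U2" "U1 \<inter> U2 = {}" "U1 \<union> U2 = W2"
      by (rule two_pathsE)
    have "spans a b (T1 \<union> U2 \<union> T3)"
      by (rule spans_join3[OF z(1) U(2) w(2) adj[OF zW(1)] adj[OF zW(2)]])
        (use ST(4) z(4,5) w(4) U(4) disj in blast)+
    \<comment> \<open>\<open>d\<close> is now an isolated end; it is linked to \<open>c\<close>
      through \<open>f d\<close>, the other path in \<open>W2\<close>, \<open>f y\<close> and
      \<open>y\<close>.\<close>
    moreover have "spans d c ({d} \<union> U1 \<union> S)"
      by (rule spans_join3[OF spans.single U(1) ST(1) adj[OF zW(4)] adj[OF zW(3)]])
        (use ST(3,4) \<open>d \<in> T\<close> U(4) disj in blast)+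
    ultimately show ?thesis
      by (intro two_pathsI[OF _ spans_sym]) (use ST(3,4) z(4,5) w(3,4) U(3,4) disj in blast)+
  qed
qed

section \<open>Two vertices of colour \<open>k\<close> and \<open>g\<close> deleted in
  \<open>A\<close>, one of colour \<open>k\<close> deleted in \<open>B\<close>\<close>

locale split31 = halves +
  fixes k :: bool and r1 r2 r3 g :: "bool list"
  assumes rA: "r1 \<in> cls A k" "r2 \<in> cls A k" "r1 \<noteq> r2" and gA: "g \<in> cls A (\<not> k)" and rB: "r3 \<in> cls B k"
begin

definition "WA = A - {r1, r2, g}"
definition "WB = B - {r3}"

lemma W_disj: "WA \<inter> WB = {}"
  using disj by (auto simp: WA_def WB_def)

lemma NG_A:
  assumes "{s, a, b} \<subseteq> cls A (\<not> k)" "distinct [g, s, a, b]"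
  obtains p where "p \<in> cls A k" "p \<notin> {r1, r2, x1, x2}" "two_paths WA p s a b"
  unfolding WA_def using assms rA gA
  by (elim weak_NG_rrgD[OF NGw cubes(1), where ?x1.0 = x1 and ?x2.0 = x2, rotated -1]) auto

lemma G_A: "{a, b} \<subseteq> cls A (\<not> k) \<Longrightarrow> distinct [g, a, b] \<Longrightarrow> spans a b WA"
  unfolding WA_def using rA gA by (intro G_rrgD[OF G cubes(1), of _ _ k]) auto

lemma NG_B: "p \<in> cls B k \<Longrightarrow> {s, a, b} \<subseteq> cls B (\<not> k) \<Longrightarrow> r3 \<noteq> p \<Longrightarrow> distinct [s, a, b] \<Longrightarrow> two_paths WB p s a b"
  unfolding WB_def using rB by (intro NG_r[OF NN dim cubes(2), of _ _ k]) auto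

lemma G_B: "{a, b} \<subseteq> cls B (\<not> k) \<Longrightarrow> a \<noteq> b \<Longrightarrow> spans a b WB"
  unfolding WB_def using rB by (intro G_r[OF NN dim cubes(2), of _ k]) auto

lemma cross_both:
  assumes "{a, c} \<subseteq> cls A (\<not> k)" "{b, d} \<subseteq> cls B (\<not> k)" "distinct [g, a, c]" "b \<noteq> d"
  shows "two_paths (WA \<union> WB) a b c d"
proof -
  obtain z where z: "z \<in> A" "red z = (\<not> k)" "z \<notin> set [g, a, c, f r3]"
    by (rule pick_vertex[OF cubes(1) dim, of "[g, a, c, f r3]" "\<not> k"]) auto
  \<comment> \<open>\<open>f x\<close> has the colour of \<open>b\<close> and \<open>d\<close> and
    must differ from both. This is the origin of the two excluded vertices in
    \<open>weak_NG_rrg\<close>.\<close>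
  obtain x where x: "x \<in> cls A k" "x \<notin> {r1, r2, f b, f d}" "two_paths WA x a c z"
    by (rule NG_A[of a c z "f b" "f d"]) (use assms z in auto)
  have "two_paths WB (f z) d (f x) b"
    by (rule NG_B) (use assms x z in \<open>auto simp: red_A f_A f_eq\<close>)
  then have "two_paths WB (f x) b (f z) d" by (rule two_paths_swap)
  with two_paths_rev[OF x(3)] show ?thesis
    by (rule two_paths_cross2) (use adj_A x z W_disj in auto)
qed

lemma cross_one_A:
  assumes "{a, c, d} \<subseteq> cls A (\<not> k)" "b \<in> cls B (\<not> k)" "distinct [g, a, c, d]"
  shows "two_paths (WA \<union> WB) a b c d"
proof -
  obtain x where x: "x \<in> cls A k" "x \<notin> {r1, r2, f b, f b}" "two_paths WA x a c d"
    by (rule NG_A[of a c d "f b" "f b"]) (use assms in auto)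
  have "spans (f x) b WB"
    by (rule G_B) (use assms x in \<open>auto simp: red_A f_A f_eq\<close>)
  with two_paths_rev[OF x(3)] show ?thesis
    by (rule two_paths_cross1) (use adj_A x W_disj in auto)
qed

lemma cross_one_B:
  assumes "{b, c, d} \<subseteq> cls B (\<not> k)" "a \<in> cls A (\<not> k)" "distinct [b, c, d]" "a \<noteq> g"
  shows "two_paths (WA \<union> WB) a b c d"
proof -
  obtain x where x: "x \<in> A" "red x = (\<not> k)" "x \<notin> set [g, a, f r3]"
    by (rule pick_vertex[OF cubes(1) dim, of "[g, a, f r3]" "\<not> k"]) auto
  have "spans x a WA"
    by (rule G_A) (use assms x gA in auto)
  moreover have "two_paths WB (f x) b c d"
    by (rule NG_B) (use assms x in \<open>auto simp: red_A f_A f_eq\<close>)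
  moreover have "adjacent (f x) x" using adj_A[OF x(1)] adjacent_sym by blast
  ultimately have "two_paths (WB \<union> WA) b a c d"
    using W_disj by (intro two_paths_cross1[OF two_paths_rev]) auto
  then show ?thesis
    using two_paths_rev by (simp add: Un_commute)
qed

lemma separate:
  assumes "{a, b} \<subseteq> cls A (\<not> k)" "{c, d} \<subseteq> cls B (\<not> k)" "distinct [g, a, b]" "c \<noteq> d"
  shows "two_paths (WA \<union> WB) a b c d"
  by (rule two_pathsI[OF G_A G_B]) (use assms W_disj in auto)

text \<open>The auxiliary end \<open>y\<close> may be any suitable vertex, so that the weak
  statement suffices in \<open>A\<close>. The vertex \<open>f d\<close> can become an end of a path
  in \<open>WB\<close>, hence it must not be \<open>r3\<close>.\<close>

lemma all_A_aux:
  assumes "{a, b, c, d} \<subseteq> cls A (\<not> k)" "distinct [g, a, b, c, d]" "f d \<noteq> r3"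
  shows "two_paths (WA \<union> WB) a b c d"
proof -
  obtain y where y: "y \<in> cls A k" "y \<notin> {r1, r2, r1, r2}" "two_paths WA y c a b"
    by (rule NG_A[of c a b r1 r2]) (use assms in auto)
  have WA: "z \<in> A" if "z \<in> WA" for z using that by (auto simp: WA_def)
  have red: "red z = k" if "adjacent z d" for z using adjacent_red[OF that] assms(1) by auto
  show ?thesis
  proof (rule reroute_inner[OF y(3), where f = f])
    show "d \<in> WA" "d \<notin> {y, c, a, b}" "WA \<inter> WB = {}"
      using assms y rA W_disj by (auto simp: WA_def)
    show "adjacent v (f v)" if "v \<in> WA" for v using that WA adj_A by blast
    show "spans (f z) (f y) WB" if "z \<in> WA" "adjacent z d" "z \<noteq> y" for z
      by (rule G_B) (use that y WA red in \<open>auto simp: f_A red_A\<close>)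
    show "two_paths WB (f d) (f y) (f z) (f w)"
      if "{z, w} \<subseteq> WA" "adjacent z d" "adjacent w d" "distinct [y, z, w]" for z w
      by (rule NG_B) (use that y WA red assms in \<open>auto simp: f_A red_A\<close>)
  qed
qed

lemma all_A:
  assumes "{a, b, c, d} \<subseteq> cls A (\<not> k)" "distinct [g, a, b, c, d]"
  shows "two_paths (WA \<union> WB) a b c d"
proof (cases "f d = r3")
  case False
  then show ?thesis using all_A_aux assms by blast
next
  case True
  then have "f c \<noteq> r3" using assms by (auto simp: f_eq)
  then have "two_paths (WA \<union> WB) a b d c"
    using assms by (intro all_A_aux) auto
  then show ?thesis by (rule two_paths_rev2)
qed

text \<open>Rerouting may require a neutral path in \<open>WA\<close> with the prescribed end
  \<open>f d\<close>, which takes the full \<open>NG_rrg\<close>. The assumptions on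
  \<open>d\<close> say that \<open>f d\<close> is not deleted and that no neighbour of
  \<open>d\<close> is opposite to \<open>g\<close>.\<close>

lemma all_B:
  assumes "{a, b, c, d} \<subseteq> cls B (\<not> k)" "distinct [a, b, c, d]"
    and full: "NG_rrg n" and d: "f d \<noteq> r1" "f d \<noteq> r2" "\<not> adjacent (f g) d"
  shows "two_paths (WA \<union> WB) a b c d"
proof -
  obtain y where y: "y \<in> B" "red y = k" "y \<notin> set [r3, f g]"
    by (rule pick_vertex[OF cubes(2) dim, of "[r3, f g]" k]) auto
  have P: "two_paths WB y c a b"
    by (rule NG_B) (use assms y in auto)
  have WB: "z \<in> B" if "z \<in> WB" for z using that by (auto simp: WB_def)
  have red: "red z = k" "f z \<noteq> g" if "adjacent z d" for z
    using adjacent_red[OF that] assms(1) that d(3) by auto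
  have gy: "f y \<noteq> g" using y f_eq by auto
  have "two_paths (WB \<union> WA) a b c d"
  proof (rule reroute_inner[OF P, where f = f])
    show "d \<in> WB" "d \<notin> {y, c, a, b}" "WB \<inter> WA = {}"
      using assms y rB W_disj by (auto simp: WB_def)
    show "adjacent v (f v)" if "v \<in> WB" for v using that WB adj_B by blast
    show "spans (f z) (f y) WA" if "z \<in> WB" "adjacent z d" "z \<noteq> y" for z
      by (rule G_A) (use that y gy WB red in \<open>auto simp: f_B red_B\<close>)
    show "two_paths WA (f d) (f y) (f z) (f w)"
      if "{z, w} \<subseteq> WB" "adjacent z d" "adjacent w d" "distinct [y, z, w]" for z w
      unfolding WA_def
      by (rule NG_rrgD[OF full cubes(1), of _ _ _ k])
        (use that y gy WB red[OF that(2)] red[OF that(3)] assms(1) d rA gA in \<open>auto simp: f_B red_B\<close>)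
  qed
  then show ?thesis by (simp add: Un_commute)
qed

lemma split31_cover:
  assumes "{a, b, c, d} \<subseteq> cls (A \<union> B) (\<not> k)" "distinct [g, a, b, c, d]"
    and all_B_ok: "{a, b, c, d} \<subseteq> B \<Longrightarrow> NG_rrg n \<and> f d \<noteq> r1 \<and> f d \<noteq> r2 \<and> \<not> adjacent (f g) d"
  shows "two_paths (A \<union> B - {r1, r2, r3, g}) a b c d"
proof -
  have "two_paths (WA \<union> WB) a b c d"
  proof (rule two_paths_by_sides[OF _ _ _ _ _ _ assms(1,2)])
    show "two_paths (WA \<union> WB) a b c d" if "{a, b, c, d} \<subseteq> cls A (\<not> k)" "distinct [g, a, b, c, d]" for a b c d
      using that by (intro all_A) auto
    show "two_paths (WA \<union> WB) a b c d"
      if "{a, c, d} \<subseteq> cls A (\<not> k)" "b \<in> cls B (\<not> k)" "distinct [g, a, b, c, d]" for a b c d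
      using that by (intro cross_one_A) auto
    show "two_paths (WA \<union> WB) a b c d"
      if "{a, c} \<subseteq> cls A (\<not> k)" "{b, d} \<subseteq> cls B (\<not> k)" "distinct [g, a, b, c, d]" for a b c d
      using that by (intro cross_both) auto
    show "two_paths (WA \<union> WB) a b c d"
      if "{a, b} \<subseteq> cls A (\<not> k)" "{c, d} \<subseteq> cls B (\<not> k)" "distinct [g, a, b, c, d]" for a b c d
      using that by (intro separate) auto
    show "two_paths (WA \<union> WB) a b c d"
      if "a \<in> cls A (\<not> k)" "{b, c, d} \<subseteq> cls B (\<not> k)" "distinct [g, a, b, c, d]" for a b c d
      using that by (intro cross_one_B) auto
    show "two_paths (WA \<union> WB) a b c d" if "{a, b, c, d} \<subseteq> cls B (\<not> k)"
      using that assms(1,2) all_B_ok disj by (intro all_B) auto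
  qed
  moreover have "WA \<union> WB = A \<union> B - {r1, r2, r3, g}"
    using rA rB gA disj by (auto simp: WA_def WB_def)
  ultimately show ?thesis by simp
qed

end

section \<open>The induction on the dimension\<close>

locale bigger_cube =
  fixes n :: nat and x :: "bool list" and D :: "nat set" and k :: bool and g a b c d :: "bool list"
  assumes facts: "cube_facts n" and full: "n = 4 \<or> NG_rrg n"
    and D: "D \<subseteq> {..<length x}" "card D = Suc n"
    and greens: "{g, a, b, c, d} \<subseteq> cls (subcube x D) (\<not> k)" "distinct [g, a, b, c, d]"
begin

abbreviation "V \<equiv> subcube x D"

definition differs :: "bool list \<Rightarrow> nat \<Rightarrow> bool" where
  "differs v i \<longleftrightarrow> v ! i \<noteq> g ! i"

abbreviation "side s i \<equiv> {v \<in> V. v ! i = s}"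

lemma halves_side:
  assumes "i \<in> D" "t = (\<not> s)"
  shows "halves n (side s i) (side t i) (flip i)"
proof unfold_locales
  have fin: "finite D" using D(1) by (meson finite_lessThan finite_subset)
  have "cube n (side u i)" for u
    unfolding cube_def subcube_half[OF assms(1) D(1), symmetric]
    using D assms(1) fin by (intro exI[of _ "x[i := u]"] exI[of _ "D - {i}"]) auto
  then show "cube n (side s i)" "cube n (side t i)" by blast+
  show "side s i \<inter> side t i = {}" using assms(2) by auto
  have i: "i < length v" if "v \<in> V" for v using that assms(1) D(1) subcube_length by auto
  have fl: "flip i v \<in> V" "flip i v ! i = (\<not> v ! i)" if "v \<in> V" for v
    using flip_in_subcube[OF that assms(1) D(1)] nth_flip i[OF that] by auto
  show "flip i v \<in> side t i" if "v \<in> side s i" for v using that fl assms(2) by auto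
  show "flip i v \<in> side s i" if "v \<in> side t i" for v using that fl assms(2) by auto
  show "adjacent v (flip i v)" if "v \<in> side s i \<union> side t i" for v
    using that i adjacent_flip by auto
qed (use facts in auto)

lemma split_two_two:
  assumes "{r1, r2, r3} \<subseteq> cls V k" "r1 \<noteq> r2" "i \<in> D" "differs r1 i" "differs r2 i" "\<not> differs r3 i"
  shows "two_paths (V - {r1, r2, r3, g}) a b c d"
proof -
  interpret halves n "side (\<not> g ! i) i" "side (g ! i) i" "flip i"
    by (rule halves_side) (use assms(3) in auto)
  interpret split22 n "side (\<not> g ! i) i" "side (g ! i) i" "flip i" k r1 r2 r3 g
    by unfold_locales (use assms greens in \<open>auto simp: differs_def\<close>)
  have "side (\<not> g ! i) i \<union> side (g ! i) i = V" by auto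
  with split22_cover[of a b c d] greens show ?thesis by auto
qed

lemma split_three_one:
  assumes "{r1, r2, r3} \<subseteq> cls V k" "r1 \<noteq> r2" "i \<in> D" "\<not> differs r1 i" "\<not> differs r2 i" "differs r3 i"
    and "(\<And>v. v \<in> {a, b, c, d} \<Longrightarrow> differs v i) \<Longrightarrow>
      NG_rrg n \<and> flip i d \<noteq> r1 \<and> flip i d \<noteq> r2 \<and> \<not> adjacent (flip i g) d"
  shows "two_paths (V - {r1, r2, r3, g}) a b c d"
proof -
  interpret halves n "side (g ! i) i" "side (\<not> g ! i) i" "flip i"
    by (rule halves_side) (use assms(3) in auto)
  interpret split31 n "side (g ! i) i" "side (\<not> g ! i) i" "flip i" k r1 r2 r3 g
    by unfold_locales (use assms greens in \<open>auto simp: differs_def\<close>)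
  have *: "side (g ! i) i \<union> side (\<not> g ! i) i = V" by auto
  have "two_paths (side (g ! i) i \<union> side (\<not> g ! i) i - {r1, r2, r3, g}) a b c d"
    by (rule split31_cover) (use * greens assms(7) in \<open>auto simp: differs_def\<close>)
  then show ?thesis by (simp only: *)
qed

text \<open>If the vertices agreed outside \<open>i\<close>, they would be equal or each other's
  flip, and a flip changes the colour.\<close>

lemma same_colour_not_flip:
  assumes "{r, r'} \<subseteq> cls V k" "r \<noteq> r'" "i \<in> D"
  shows "\<exists>m \<in> D - {i}. r ! m \<noteq> r' ! m"
proof (rule ccontr)
  assume "\<not> ?thesis"
  then have same: "r ! m = r' ! m" if "m \<in> D" "m \<noteq> i" for m using that by auto
  have len: "length r = length x" "length r' = length x" using assms(1) subcube_length by auto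
  have out: "r ! m = r' ! m" if "m < length x" "m \<notin> D" for m
    using assms(1) that by (auto simp: subcube_def)
  have i: "i < length r" using assms(3) D(1) len by auto
  have "r' = r \<or> r' = flip i r"
  proof (cases "r ! i = r' ! i")
    case True
    then have "r ! m = r' ! m" if "m < length x" for m using that same out by (cases "m \<in> D"; cases "m = i") auto
    then have "r = r'" using len by (intro nth_equalityI) auto
    then show ?thesis by simp
  next
    case False
    then have "r' ! m = flip i r ! m" if "m < length x" for m
      using that same out i nth_flip[OF i, of m] by (cases "m \<in> D"; cases "m = i") auto
    then have "r' = flip i r" using len by (intro nth_equalityI) auto
    then show ?thesis by simp
  qed
  then show False using assms(1,2) red_flip[OF i] by auto
qed

lemma differ_somewhere:
  assumes "{v, w} \<subseteq> V" "v \<noteq> w"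
  shows "\<exists>m \<in> D. v ! m \<noteq> w ! m"
proof (rule ccontr)
  assume "\<not> ?thesis"
  then have "v = w" using assms by (intro nth_equalityI) (auto simp: subcube_def)
  then show False using assms by simp
qed

text \<open>
  Coordinates in which exactly one of the \<open>r\<close>'s differs from \<open>g\<close> are suitable for splitting, unless
  \<open>a\<close>, \<open>b\<close>, \<open>c\<close>, \<open>d\<close> are all on the side of this \<open>r\<close>. If this happens for all such coordinates,
  then \<open>d\<close> is far enough from \<open>g\<close> and from the other \<open>r\<close>'s.
\<close>

lemma no_two_two:
  assumes "{r1, r2, r3} \<subseteq> cls V k" "distinct [r1, r2, r3]"
    and no: "\<And>m. m \<in> D \<Longrightarrow> \<not> (differs r1 m \<and> differs r2 m \<and> \<not> differs r3 m)"
      "\<And>m. m \<in> D \<Longrightarrow> \<not> (differs r1 m \<and> \<not> differs r2 m \<and> differs r3 m)"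
      "\<And>m. m \<in> D \<Longrightarrow> \<not> (\<not> differs r1 m \<and> differs r2 m \<and> differs r3 m)"
    and i: "i \<in> D" "differs r1 i" "\<not> differs r2 i" "\<not> differs r3 i"
    and j: "j \<in> D" "\<not> differs r1 j" "differs r2 j" "\<not> differs r3 j"
  shows "two_paths (V - {r1, r2, r3, g}) a b c d"
proof -
  define U1 where "U1 = {m \<in> D. differs r1 m \<and> \<not> differs r2 m \<and> \<not> differs r3 m}"
  define U2 where "U2 = {m \<in> D. \<not> differs r1 m \<and> differs r2 m \<and> \<not> differs r3 m}"
  define U3 where "U3 = {m \<in> D. \<not> differs r1 m \<and> \<not> differs r2 m \<and> differs r3 m}"
  have perms: "{r2, r3, r1, g} = {r1, r2, r3, g}" "{r1, r3, r2, g} = {r1, r2, r3, g}" by auto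
  show ?thesis
  proof (cases "\<forall>m \<in> U1 \<union> U2 \<union> U3. \<forall>v \<in> {a, b, c, d}. differs v m")
    case False
    then obtain m v where m: "m \<in> U1 \<union> U2 \<union> U3" "v \<in> {a, b, c, d}" "\<not> differs v m" by blast
    have D1: "two_paths (V - {r2, r3, r1, g}) a b c d" if "m \<in> U1"
      by (rule split_three_one[of _ _ _ m]) (use that m assms(1,2) in \<open>auto simp: U1_def\<close>)
    have D2: "two_paths (V - {r1, r3, r2, g}) a b c d" if "m \<in> U2"
      by (rule split_three_one[of _ _ _ m]) (use that m assms(1,2) in \<open>auto simp: U2_def\<close>)
    have D3: "two_paths (V - {r1, r2, r3, g}) a b c d" if "m \<in> U3"
      by (rule split_three_one[of _ _ _ m]) (use that m assms(1,2) in \<open>auto simp: U3_def\<close>)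
    show ?thesis using D1 D2 D3 m(1) unfolding perms by blast
  next
    case True
    have dU: "differs v m" if "v \<in> {a, b, c, d}" "m \<in> U1 \<union> U2 \<union> U3" for v m using True that by blast
    have iU: "i \<in> U1" "j \<in> U2" "i \<noteq> j" using i j by (auto simp: U1_def U2_def)
    text \<open>\<open>r1\<close> and \<open>r3\<close> have the same colour, so they differ in a coordinate other than \<open>i\<close>.\<close>
    obtain m0 where "m0 \<in> D" "m0 \<noteq> i" "r1 ! m0 \<noteq> r3 ! m0"
      using same_colour_not_flip[of r1 r3 i] assms(1,2) i(1) by auto
    \<comment> \<open>Exactly one of \<open>r1\<close> and \<open>r3\<close> differs from
      \<open>g\<close> in \<open>m0\<close>, and by \<open>no\<close> it is then the only one of the
      three that does.\<close>
    then have "m0 \<in> U1 \<union> U3" "m0 \<noteq> i"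
      using no[of m0] by (auto simp: U1_def U3_def differs_def)
    then have m0: "m0 \<in> U1 \<union> U3" "m0 \<noteq> i" "m0 \<noteq> j" "m0 \<in> D"
      using j by (auto simp: U1_def U3_def)
    have len: "length v = length x" if "v \<in> V" for v using that subcube_length by auto
    have gV: "g \<in> V" "d \<in> V" using greens by auto
    have iD: "i < length g" "i < length d" using i(1) D(1) len[OF gV(1)] len[OF gV(2)] by auto
    \<comment> \<open>\<open>d\<close> differs from \<open>g\<close> in \<open>i\<close>,
      \<open>j\<close> and \<open>m0\<close>, hence from \<open>flip i g\<close> in at least two
      coordinates.\<close>
    have "\<not> adjacent (flip i g) d"
    proof
      assume "adjacent (flip i g) d"
      then obtain m where m: "m < length g" "d = flip m (flip i g)" unfolding adjacent_def by auto
      have "m = u" if "differs d u" "u \<noteq> i" for u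
        using that m iD by (auto simp: differs_def nth_flip split: if_splits)
      then show False using dU[of d j] dU[of d m0] iU m0 by auto
    qed
    \<comment> \<open>In \<open>m0\<close>, \<open>r2\<close> agrees with \<open>g\<close> while
      \<open>flip i d\<close> does not. For \<open>r3\<close>, the coordinate \<open>j\<close>
      serves the same purpose.\<close>
    moreover have "flip i d \<noteq> r2"
    proof
      assume *: "flip i d = r2"
      have "\<not> differs r2 m0" using m0 by (auto simp: U1_def U3_def)
      moreover have "differs d m0" using dU m0 by auto
      ultimately show False using * m0 iD nth_flip[of i d m0] by (auto simp: differs_def)
    qed
    moreover have "flip i d \<noteq> r3"
    proof
      assume *: "flip i d = r3"
      moreover have "differs d j" using dU iU by auto
      ultimately show False using j(4) iU(3) iD nth_flip[of i d j] by (auto simp: differs_def)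
    qed
    \<comment> \<open>In a 5-dimensional cube, fixing \<open>i\<close>, \<open>j\<close> and
      \<open>m0\<close> leaves a square with two vertices of each colour, which cannot contain all
      of \<open>a\<close>, \<open>b\<close>, \<open>c\<close>, \<open>d\<close>.\<close>
    moreover have "n \<noteq> 4"
    proof
      assume n: "n = 4"
      have fin: "finite D" using D(1) by (meson finite_lessThan finite_subset)
      have sub: "{a, b, c, d} \<subseteq> cls (subcube a (D - {i, j, m0})) (\<not> k)"
      proof
        fix v assume v: "v \<in> {a, b, c, d}"
        have vV: "v \<in> V" "a \<in> V" "red v = (\<not> k)" using v greens by auto
        have "v ! m = a ! m" if "m \<in> {i, j, m0}" for m
          using dU[OF v, of m] dU[of a m] that iU m0 by (auto simp: differs_def)
        then have "v \<in> subcube a (D - {i, j, m0})"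
          using vV by (auto simp: subcube_def)
        then show "v \<in> cls (subcube a (D - {i, j, m0})) (\<not> k)" using vV by simp
      qed
      have "card (D - {i, j, m0}) = Suc 1"
        using card_Diff_subset[of "{i, j, m0}" D] i(1) j(1) m0 iU(3) D(2) n by auto
      moreover have "D - {i, j, m0} \<subseteq> {..<length a}" using D(1) greens len by auto
      ultimately have "card (cls (subcube a (D - {i, j, m0})) (\<not> k)) = 2 ^ 1"
        by (intro card_cls_subcube) auto
      moreover have "finite (cls (subcube a (D - {i, j, m0})) (\<not> k))"
        by (simp add: cls_def finite_subcube)
      moreover have "card {a, b, c, d} = 4" using greens(2) by auto
      ultimately show False using card_mono[OF _ sub] by simp
    qed
    ultimately have "two_paths (V - {r2, r3, r1, g}) a b c d"
      using full by (intro split_three_one[of _ _ _ i]) (use assms(1,2) i in auto)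
    then show ?thesis by (simp only: perms)
  qed
qed

text \<open>If no coordinate allows \<open>split_two_two\<close>, each coordinate that separates two
  of the \<open>r\<close>'s isolates one of these two. As all three pairs have to be separated, at
  least two of the \<open>r\<close>'s are isolated somewhere, and \<open>no_two_two\<close> applies
  to them.\<close>

lemma bigger_cube_cover:
  assumes "{r1, r2, r3} \<subseteq> cls V k" "distinct [r1, r2, r3]"
  shows "two_paths (V - {r1, r2, r3, g}) a b c d"
proof -
  have perms: "{r1, r3, r2, g} = {r1, r2, r3, g}" "{r2, r3, r1, g} = {r1, r2, r3, g}"
    "{r3, r2, r1, g} = {r1, r2, r3, g}" by auto
  consider
    (12) m where "m \<in> D" "differs r1 m" "differs r2 m" "\<not> differs r3 m"
  | (13) m where "m \<in> D" "differs r1 m" "\<not> differs r2 m" "differs r3 m"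
  | (23) m where "m \<in> D" "\<not> differs r1 m" "differs r2 m" "differs r3 m"
  | (no) "\<And>m. m \<in> D \<Longrightarrow> \<not> (differs r1 m \<and> differs r2 m \<and> \<not> differs r3 m)"
      "\<And>m. m \<in> D \<Longrightarrow> \<not> (differs r1 m \<and> \<not> differs r2 m \<and> differs r3 m)"
      "\<And>m. m \<in> D \<Longrightarrow> \<not> (\<not> differs r1 m \<and> differs r2 m \<and> differs r3 m)"
    by blast
  then show ?thesis
  proof cases
    case 12
    then show ?thesis using assms by (intro split_two_two) auto
  next
    case 13
    then have "two_paths (V - {r1, r3, r2, g}) a b c d" using assms by (intro split_two_two) auto
    then show ?thesis by (simp only: perms)
  next
    case 23
    then have "two_paths (V - {r2, r3, r1, g}) a b c d" using assms by (intro split_two_two) auto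
    then show ?thesis by (simp only: perms)
  next
    case no
    define P where "P i r r' r'' \<longleftrightarrow> i \<in> D \<and> differs r i \<and> \<not> differs r' i \<and> \<not> differs r'' i" for i r r' r''
    obtain m1 m2 m3 where m: "m1 \<in> D" "r1 ! m1 \<noteq> r2 ! m1" "m2 \<in> D" "r1 ! m2 \<noteq> r3 ! m2" "m3 \<in> D" "r2 ! m3 \<noteq> r3 ! m3"
      using differ_somewhere[of r1 r2] differ_somewhere[of r1 r3] differ_somewhere[of r2 r3] assms by auto
    have "P m1 r1 r2 r3 \<or> P m1 r2 r1 r3" "P m2 r1 r2 r3 \<or> P m2 r3 r1 r2" "P m3 r2 r1 r3 \<or> P m3 r3 r1 r2"
      using m no[of m1] no[of m2] no[of m3] unfolding P_def differs_def by blast+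
    then consider i j where "P i r1 r2 r3" "P j r2 r1 r3" | i j where "P i r1 r2 r3" "P j r3 r1 r2"
      | i j where "P i r2 r1 r3" "P j r3 r1 r2" by blast
    then show ?thesis
    proof cases
      case (1 i j)
      then show ?thesis using assms no by (intro no_two_two[of r1 r2 r3 i j]) (auto simp: P_def)
    next
      case (2 i j)
      then have "two_paths (V - {r1, r3, r2, g}) a b c d"
        using assms no by (intro no_two_two[of r1 r3 r2 i j]) (auto simp: P_def)
      then show ?thesis by (simp only: perms)
    next
      case (3 i j)
      then have "two_paths (V - {r2, r3, r1, g}) a b c d"
        using assms no by (intro no_two_two[of r2 r3 r1 i j]) (auto simp: P_def)
      then show ?thesis by (simp only: perms)
    qed
  qed
qed

end

lemma GG_rrrg_step:
  assumes "cube_facts n" "n = 4 \<or> NG_rrg n"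
  shows "GG_rrrg (Suc n)"
  unfolding GG_rrrg_def
proof (intro allI impI)
  fix V k r1 r2 r3 g a b c d
  assume *: "cube (Suc n) V" "{r1, r2, r3} \<subseteq> cls V k" "{g, a, b, c, d} \<subseteq> cls V (\<not> k)"
    "distinct [r1, r2, r3]" "distinct [g, a, b, c, d]"
  obtain x D where xD: "D \<subseteq> {..<length x}" "card D = Suc n" "V = subcube x D"
    using *(1) unfolding cube_def by blast
  interpret bigger_cube n x D k g a b c d
    using assms xD(1,2) *(3,5) unfolding xD(3) by (rule bigger_cube.intro)
  show "two_paths (V - {r1, r2, r3, g}) a b c d"
    using bigger_cube_cover *(2,4) unfolding xD(3) by blast
qed

lemma cube_facts_of_GG_rrrg:
  assumes "GG_rrrg n" "5 \<le> n"
  shows "cube_facts n"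
  using assms NG_rrg_of_GG_rrrg NN_rg_of_NG_rrg GG_rr_of_NG_rrg G_rrg_of_NG_rrg weak_NG_rrg_of_NG_rrg
  by (simp add: cube_facts_def)

lemma GG_rrrg_all:
  assumes "cube_facts 4" "5 \<le> n"
  shows "GG_rrrg n"
  using assms(2)
proof (induction n rule: dec_induct)
  case base
  show ?case using GG_rrrg_step[OF assms(1)] by simp
next
  case (step m)
  then show ?case using GG_rrrg_step cube_facts_of_GG_rrrg NG_rrg_of_GG_rrrg by blast
qed

section \<open>Four-dimensional cubes\<close>

text \<open>
  The vertices of a 4-dimensional cube are coded by the coordinates in which they differ from a base
  vertex; the least significant bit of the hexadecimal digit is the first coordinate.
\<close>

datatype code = X0 | X1 | X2 | X3 | X4 | X5 | X6 | X7 | X8 | X9 | XA | XB | XC | XD | XE | XF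

instance code :: finite
proof
  have "(UNIV :: code set) \<subseteq> {X0, X1, X2, X3, X4, X5, X6, X7, X8, X9, XA, XB, XC, XD, XE, XF}"
    using code.exhaust by blast
  then show "finite (UNIV :: code set)" by (rule finite_subset) simp
qed

fun bits :: "code \<Rightarrow> bool list" where
  "bits X0 = [False, False, False, False]"
| "bits X1 = [True, False, False, False]"
| "bits X2 = [False, True, False, False]"
| "bits X3 = [True, True, False, False]"
| "bits X4 = [False, False, True, False]"
| "bits X5 = [True, False, True, False]"
| "bits X6 = [False, True, True, False]"
| "bits X7 = [True, True, True, False]"
| "bits X8 = [False, False, False, True]"
| "bits X9 = [True, False, False, True]"
| "bits XA = [False, True, False, True]"
| "bits XB = [True, True, False, True]"
| "bits XC = [False, False, True, True]"
| "bits XD = [True, False, True, True]"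
| "bits XE = [False, True, True, True]"
| "bits XF = [True, True, True, True]"

fun nbrs :: "code \<Rightarrow> code list" where
  "nbrs X0 = [X1, X2, X4, X8]"
| "nbrs X1 = [X0, X3, X5, X9]"
| "nbrs X2 = [X3, X0, X6, XA]"
| "nbrs X3 = [X2, X1, X7, XB]"
| "nbrs X4 = [X5, X6, X0, XC]"
| "nbrs X5 = [X4, X7, X1, XD]"
| "nbrs X6 = [X7, X4, X2, XE]"
| "nbrs X7 = [X6, X5, X3, XF]"
| "nbrs X8 = [X9, XA, XC, X0]"
| "nbrs X9 = [X8, XB, XD, X1]"
| "nbrs XA = [XB, X8, XE, X2]"
| "nbrs XB = [XA, X9, XF, X3]"
| "nbrs XC = [XD, XE, X8, X4]"
| "nbrs XD = [XC, XF, X9, X5]"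
| "nbrs XE = [XF, XC, XA, X6]"
| "nbrs XF = [XE, XD, XB, X7]"

text \<open>One bit per vertex: membership and update become single equations, which keeps the
  evaluation of the searches cheap.\<close>

datatype code_set = CSet bool bool bool bool bool bool bool bool bool bool bool bool bool bool bool bool

fun mem :: "code \<Rightarrow> code_set \<Rightarrow> bool" where
  "mem X0 (CSet b0 b1 b2 b3 b4 b5 b6 b7 b8 b9 bA bB bC bD bE bF) = b0"
| "mem X1 (CSet b0 b1 b2 b3 b4 b5 b6 b7 b8 b9 bA bB bC bD bE bF) = b1"
| "mem X2 (CSet b0 b1 b2 b3 b4 b5 b6 b7 b8 b9 bA bB bC bD bE bF) = b2"
| "mem X3 (CSet b0 b1 b2 b3 b4 b5 b6 b7 b8 b9 bA bB bC bD bE bF) = b3"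
| "mem X4 (CSet b0 b1 b2 b3 b4 b5 b6 b7 b8 b9 bA bB bC bD bE bF) = b4"
| "mem X5 (CSet b0 b1 b2 b3 b4 b5 b6 b7 b8 b9 bA bB bC bD bE bF) = b5"
| "mem X6 (CSet b0 b1 b2 b3 b4 b5 b6 b7 b8 b9 bA bB bC bD bE bF) = b6"
| "mem X7 (CSet b0 b1 b2 b3 b4 b5 b6 b7 b8 b9 bA bB bC bD bE bF) = b7"
| "mem X8 (CSet b0 b1 b2 b3 b4 b5 b6 b7 b8 b9 bA bB bC bD bE bF) = b8"
| "mem X9 (CSet b0 b1 b2 b3 b4 b5 b6 b7 b8 b9 bA bB bC bD bE bF) = b9"
| "mem XA (CSet b0 b1 b2 b3 b4 b5 b6 b7 b8 b9 bA bB bC bD bE bF) = bA"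
| "mem XB (CSet b0 b1 b2 b3 b4 b5 b6 b7 b8 b9 bA bB bC bD bE bF) = bB"
| "mem XC (CSet b0 b1 b2 b3 b4 b5 b6 b7 b8 b9 bA bB bC bD bE bF) = bC"
| "mem XD (CSet b0 b1 b2 b3 b4 b5 b6 b7 b8 b9 bA bB bC bD bE bF) = bD"
| "mem XE (CSet b0 b1 b2 b3 b4 b5 b6 b7 b8 b9 bA bB bC bD bE bF) = bE"
| "mem XF (CSet b0 b1 b2 b3 b4 b5 b6 b7 b8 b9 bA bB bC bD bE bF) = bF"

fun upd :: "code \<Rightarrow> bool \<Rightarrow> code_set \<Rightarrow> code_set" where
  "upd X0 t (CSet b0 b1 b2 b3 b4 b5 b6 b7 b8 b9 bA bB bC bD bE bF) = CSet t b1 b2 b3 b4 b5 b6 b7 b8 b9 bA bB bC bD bE bF"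
| "upd X1 t (CSet b0 b1 b2 b3 b4 b5 b6 b7 b8 b9 bA bB bC bD bE bF) = CSet b0 t b2 b3 b4 b5 b6 b7 b8 b9 bA bB bC bD bE bF"
| "upd X2 t (CSet b0 b1 b2 b3 b4 b5 b6 b7 b8 b9 bA bB bC bD bE bF) = CSet b0 b1 t b3 b4 b5 b6 b7 b8 b9 bA bB bC bD bE bF"
| "upd X3 t (CSet b0 b1 b2 b3 b4 b5 b6 b7 b8 b9 bA bB bC bD bE bF) = CSet b0 b1 b2 t b4 b5 b6 b7 b8 b9 bA bB bC bD bE bF"
| "upd X4 t (CSet b0 b1 b2 b3 b4 b5 b6 b7 b8 b9 bA bB bC bD bE bF) = CSet b0 b1 b2 b3 t b5 b6 b7 b8 b9 bA bB bC bD bE bF"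
| "upd X5 t (CSet b0 b1 b2 b3 b4 b5 b6 b7 b8 b9 bA bB bC bD bE bF) = CSet b0 b1 b2 b3 b4 t b6 b7 b8 b9 bA bB bC bD bE bF"
| "upd X6 t (CSet b0 b1 b2 b3 b4 b5 b6 b7 b8 b9 bA bB bC bD bE bF) = CSet b0 b1 b2 b3 b4 b5 t b7 b8 b9 bA bB bC bD bE bF"
| "upd X7 t (CSet b0 b1 b2 b3 b4 b5 b6 b7 b8 b9 bA bB bC bD bE bF) = CSet b0 b1 b2 b3 b4 b5 b6 t b8 b9 bA bB bC bD bE bF"
| "upd X8 t (CSet b0 b1 b2 b3 b4 b5 b6 b7 b8 b9 bA bB bC bD bE bF) = CSet b0 b1 b2 b3 b4 b5 b6 b7 t b9 bA bB bC bD bE bF"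
| "upd X9 t (CSet b0 b1 b2 b3 b4 b5 b6 b7 b8 b9 bA bB bC bD bE bF) = CSet b0 b1 b2 b3 b4 b5 b6 b7 b8 t bA bB bC bD bE bF"
| "upd XA t (CSet b0 b1 b2 b3 b4 b5 b6 b7 b8 b9 bA bB bC bD bE bF) = CSet b0 b1 b2 b3 b4 b5 b6 b7 b8 b9 t bB bC bD bE bF"
| "upd XB t (CSet b0 b1 b2 b3 b4 b5 b6 b7 b8 b9 bA bB bC bD bE bF) = CSet b0 b1 b2 b3 b4 b5 b6 b7 b8 b9 bA t bC bD bE bF"
| "upd XC t (CSet b0 b1 b2 b3 b4 b5 b6 b7 b8 b9 bA bB bC bD bE bF) = CSet b0 b1 b2 b3 b4 b5 b6 b7 b8 b9 bA bB t bD bE bF"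
| "upd XD t (CSet b0 b1 b2 b3 b4 b5 b6 b7 b8 b9 bA bB bC bD bE bF) = CSet b0 b1 b2 b3 b4 b5 b6 b7 b8 b9 bA bB bC t bE bF"
| "upd XE t (CSet b0 b1 b2 b3 b4 b5 b6 b7 b8 b9 bA bB bC bD bE bF) = CSet b0 b1 b2 b3 b4 b5 b6 b7 b8 b9 bA bB bC bD t bF"
| "upd XF t (CSet b0 b1 b2 b3 b4 b5 b6 b7 b8 b9 bA bB bC bD bE bF) = CSet b0 b1 b2 b3 b4 b5 b6 b7 b8 b9 bA bB bC bD bE t"

definition without :: "code list \<Rightarrow> code_set" where
  "without vs = fold (\<lambda>v. upd v False) vs
     (CSet True True True True True True True True True True True True True True True True)"

text \<open>
  The first argument of the searches is the number of free vertices; it makes them structurally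
  recursive and replaces a test for emptiness. In \<open>search2\<close>, the vertex \<open>d\<close> becomes free only after
  the first path is complete.
\<close>

fun search1 :: "nat \<Rightarrow> code \<Rightarrow> code \<Rightarrow> code_set \<Rightarrow> bool"
  and search1s :: "nat \<Rightarrow> code list \<Rightarrow> code \<Rightarrow> code_set \<Rightarrow> bool" where
  "search1 0 a b s = (a = b)"
| "search1 (Suc m) a b s = (if a = b then False else search1s m (nbrs a) b s)"
| "search1s m [] b s = False"
| "search1s m (v # vs) b s =
     (if mem v s then if search1 m v b (upd v False s) then True else search1s m vs b s
      else search1s m vs b s)"

fun search2 :: "nat \<Rightarrow> code \<Rightarrow> code \<Rightarrow> code \<Rightarrow> code \<Rightarrow> code_set \<Rightarrow> bool"
  and search2s :: "nat \<Rightarrow> code list \<Rightarrow> code \<Rightarrow> code \<Rightarrow> code \<Rightarrow> code_set \<Rightarrow> bool" where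
  "search2 0 a b c d s = (if a = b then search1 (Suc 0) c d (upd d True s) else False)"
| "search2 (Suc m) a b c d s =
     (if a = b then search1 (Suc (Suc m)) c d (upd d True s) else search2s m (nbrs a) b c d s)"
| "search2s m [] b c d s = False"
| "search2s m (v # vs) b c d s =
     (if mem v s then if search2 m v b c d (upd v False s) then True else search2s m vs b c d s
      else search2s m vs b c d s)"

text \<open>Each unordered pair is tested in one order only; the other order follows by reversing or
  exchanging paths.\<close>

fun all_pairs :: "('a \<Rightarrow> 'a \<Rightarrow> bool) \<Rightarrow> 'a list \<Rightarrow> bool" where
  "all_pairs P [] = True"
| "all_pairs P (x # xs) = (list_all (P x) xs \<and> all_pairs P xs)"

fun at_least :: "nat \<Rightarrow> ('a \<Rightarrow> bool) \<Rightarrow> 'a list \<Rightarrow> bool" where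
  "at_least 0 P xs = True"
| "at_least (Suc m) P [] = False"
| "at_least (Suc m) P (x # xs) = (if P x then at_least m P xs else at_least (Suc m) P xs)"

text \<open>\<open>X0\<close> is left out because the base vertex is always a deleted one.\<close>

definition evens :: "code list" where "evens = [X3, X5, X6, X9, XA, XC, XF]"

definition odds :: "code list" where "odds = [X1, X2, X4, X8, X7, XB, XD, XE]"

text \<open>Permuting the coordinates leaves only the distances 1 and 3 between the deleted
  vertices, represented by \<open>X1\<close> and \<open>X7\<close>. Initially
  \<open>16 - 5 = 11\<close> vertices are free; \<open>s\<close> is one of them, since it is reached
  like an inner vertex.\<close>

lemma NN_rg_check:
  "list_all (\<lambda>g. all_pairs (\<lambda>p q. list_all (\<lambda>s. list_all (\<lambda>t.
       s = t \<or> search2 11 p s q t (without [X0, g, p, q, t]))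
     (removeAll g odds)) (removeAll g odds)) evens) [X1, X7]"
  by code_simp

text \<open>Two vertices of the same colour have distance 2 or 4, represented by \<open>X3\<close>
  and \<open>XF\<close>.\<close>

lemma GG_rr_check:
  "list_all (\<lambda>r. all_pairs (\<lambda>a b. all_pairs (\<lambda>c d.
       search2 11 a b c d (without [X0, r, a, c, d]))
     (removeAll a (removeAll b odds))) odds) [X3, XF]"
  by code_simp

lemma G_rrg_check:
  "list_all (\<lambda>r. list_all (\<lambda>g. all_pairs (\<lambda>a b. search1 12 a b (without [X0, r, g, a]))
     (removeAll g odds)) odds) [X3, XF]"
  by code_simp

text \<open>Three suitable ends \<open>p\<close> are demanded, so that one remains when
  \<open>x1\<close> and \<open>x2\<close> are excluded. The charged path is searched first;
  \<open>s\<close> and \<open>p\<close> are the ends of the second path.\<close>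

lemma weak_NG_rrg_check_X3:
  "list_all (\<lambda>g. list_all (\<lambda>s. all_pairs (\<lambda>a b. at_least 3 (\<lambda>p.
       search2 10 a b s p (without [X0, X3, g, a, s, p])) (removeAll X3 evens))
     (removeAll s (removeAll g odds))) (removeAll g odds)) odds"
  by code_simp

lemma weak_NG_rrg_check_XF:
  "list_all (\<lambda>g. list_all (\<lambda>s. all_pairs (\<lambda>a b. at_least 3 (\<lambda>p.
       search2 10 a b s p (without [X0, XF, g, a, s, p])) (removeAll XF evens))
     (removeAll s (removeAll g odds))) (removeAll g odds)) odds"
  by code_simp

section \<open>Soundness of the search\<close>

lemma mem_upd: "mem v (upd w t s) = (if v = w then t else mem v s)"
  by (cases s; cases v; cases w) simp_all

lemma mem_without: "mem v (without vs) \<longleftrightarrow> v \<notin> set vs"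
proof -
  have "mem v (fold (\<lambda>v. upd v False) vs s) \<longleftrightarrow> v \<notin> set vs \<and> mem v s" for s
    by (induction vs arbitrary: s) (auto simp: mem_upd)
  then show ?thesis unfolding without_def by (cases v) auto
qed

lemma search1s_iff: "search1s m vs b s \<longleftrightarrow> (\<exists>v \<in> set vs. mem v s \<and> search1 m v b (upd v False s))"
  by (induction vs) auto

lemma search2s_iff:
  "search2s m vs b c d s \<longleftrightarrow> (\<exists>v \<in> set vs. mem v s \<and> search2 m v b c d (upd v False s))"
  by (induction vs) auto

lemma all_pairs_dest: "all_pairs P xs \<Longrightarrow> x \<in> set xs \<Longrightarrow> y \<in> set xs \<Longrightarrow> x \<noteq> y \<Longrightarrow> P x y \<or> P y x"
  by (induction xs) (auto simp: list_all_iff)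

lemma at_least_card: "at_least m P xs \<Longrightarrow> distinct xs \<Longrightarrow> m \<le> card {x \<in> set xs. P x}"
proof (induction m P xs rule: at_least.induct)
  case (3 m P x xs)
  have "{y \<in> set (x # xs). P y} = (if P x then insert x {y \<in> set xs. P y} else {y \<in> set xs. P y})" by auto
  then show ?case using 3 by (auto split: if_splits)
qed auto

definition flips :: "nat list \<Rightarrow> bool list \<Rightarrow> bool list \<Rightarrow> bool list" where
  "flips I bs x = fold (\<lambda>(i, b) y. if b then flip i y else y) (zip I bs) x"

definition decode :: "bool list \<Rightarrow> nat list \<Rightarrow> code \<Rightarrow> bool list" where
  "decode x I v = flips I (bits v) x"

text \<open>The list \<open>I\<close> fixes an order of the free coordinates. Choosing this order is
  how the symmetry of the cube is exploited.\<close>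

locale frame =
  fixes x :: "bool list" and I :: "nat list"
  assumes frame: "distinct I" "length I = 4" "set I \<subseteq> {..<length x}"
begin

abbreviation "emb \<equiv> decode x I"

lemma frame_cases:
  obtains i j k l where "I = [i, j, k, l]" "distinct [i, j, k, l]" "{i, j, k, l} \<subseteq> {..<length x}"
proof -
  obtain i j k l where "I = [i, j, k, l]"
    using frame(2) by (auto simp: numeral_eq_Suc length_Suc_conv)
  with that frame show ?thesis by auto
qed

lemma length_emb: "length (emb v) = length x"
  by (rule frame_cases) (cases v; simp add: decode_def flips_def)

lemma emb_outside: "m < length x \<Longrightarrow> m \<notin> set I \<Longrightarrow> emb v ! m = x ! m"
  by (rule frame_cases) (cases v; simp add: decode_def flips_def nth_flip)

lemma emb_bits: "map (\<lambda>i. emb v ! i \<noteq> x ! i) I = bits v"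
  by (rule frame_cases) (cases v; simp add: decode_def flips_def nth_flip)

lemma bits_inj: "bits v = bits w \<Longrightarrow> v = w"
  by (cases v; cases w) simp_all

lemma emb_inject [simp]: "emb v = emb w \<longleftrightarrow> v = w"
  using emb_bits bits_inj by metis

lemma flip_commute: "flip i (flip j y) = flip j (flip i y)"
  by (cases "i = j"; cases "i < length y"; cases "j < length y")
    (auto simp: flip_def list_update_swap list_update_beyond nth_list_update)

lemma adjacent_emb: "w \<in> set (nbrs v) \<Longrightarrow> adjacent (emb v) (emb w)"
proof -
  assume w: "w \<in> set (nbrs v)"
  obtain i j k l where fr: "I = [i, j, k, l]" "distinct [i, j, k, l]" "{i, j, k, l} \<subseteq> {..<length x}"
    by (rule frame_cases)
  have "emb w \<in> {flip i (emb v), flip j (emb v), flip k (emb v), flip l (emb v)}"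
    using w by (cases v) (auto simp: decode_def flips_def fr(1) flip_commute[of j i] flip_commute[of k i]
      flip_commute[of l i] flip_commute[of k j] flip_commute[of l j] flip_commute[of l k])
  then show ?thesis using fr(3) adjacent_flip length_emb by auto
qed

lemma red_emb: "red (emb v) \<longleftrightarrow> (red x \<longleftrightarrow> v \<in> set (X0 # evens))"
proof -
  obtain i j k l where fr: "I = [i, j, k, l]" "distinct [i, j, k, l]" "{i, j, k, l} \<subseteq> {..<length x}"
    by (rule frame_cases)
  then show ?thesis
    by (cases v) (simp_all add: decode_def flips_def fr(1) red_flip evens_def)
qed

lemma code_cases: "v \<in> set (X0 # evens) \<longleftrightarrow> v \<notin> set odds"
  by (cases v) (simp_all add: evens_def odds_def)

lemma emb_X0: "emb X0 = x"
  by (rule frame_cases) (simp add: decode_def flips_def)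

lemma range_emb: "range emb = subcube x (set I)"
proof
  show "range emb \<subseteq> subcube x (set I)"
    using length_emb emb_outside by (auto simp: subcube_def)
  show "subcube x (set I) \<subseteq> range emb"
  proof
    fix y assume y: "y \<in> subcube x (set I)"
    have "\<exists>v. bits v = bs" if bs: "length bs = 4" for bs
    proof -
      obtain b1 b2 b3 b4 where "bs = [b1, b2, b3, b4]"
        using bs by (auto simp: numeral_eq_Suc length_Suc_conv)
      then show ?thesis
        by (cases b1; cases b2; cases b3; cases b4) (metis bits.simps)+
    qed
    then obtain v where "bits v = map (\<lambda>i. y ! i \<noteq> x ! i) I" using frame(2) by fastforce
    then have *: "\<forall>i \<in> set I. (emb v ! i \<noteq> x ! i) = (y ! i \<noteq> x ! i)"
      using emb_bits[of v] by (simp add: map_eq_conv)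
    have "emb v = y"
    proof (rule nth_equalityI)
      fix m assume "m < length (emb v)"
      then show "emb v ! m = y ! m"
        using * y emb_outside[of m v] length_emb by (cases "m \<in> set I") (auto simp: subcube_def)
    qed (use y length_emb in \<open>simp add: subcube_def\<close>)
    then show "y \<in> range emb" by blast
  qed
qed

lemma emb_cases:
  assumes "y \<in> subcube x (set I)"
  obtains v where "y = emb v"
  using assms range_emb by blast

lemma search1_sound:
  "search1 m a b s \<Longrightarrow> card {v. mem v s} = m \<Longrightarrow> \<not> mem a s \<Longrightarrow>
     spans (emb a) (emb b) (emb ` insert a {v. mem v s})"
proof (induction m arbitrary: a s)
  case 0
  then have "{v. mem v s} = {}" by simp
  then show ?case using 0(1) by (simp add: spans.single)
next
  case (Suc m)
  then obtain v where v: "v \<in> set (nbrs a)" "mem v s" "search1 m v b (upd v False s)"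
    by (auto simp: search1s_iff split: if_splits)
  have s: "{w. mem w (upd v False s)} = {w. mem w s} - {v}" by (auto simp: mem_upd)
  have "card {w. mem w (upd v False s)} = m" unfolding s using v(2) Suc.prems(2) by simp
  moreover have "\<not> mem v (upd v False s)" by (simp add: mem_upd)
  ultimately have "spans (emb v) (emb b) (emb ` insert v ({w. mem w s} - {v}))"
    using Suc.IH[OF v(3)] s by metis
  also have "insert v ({w. mem w s} - {v}) = {w. mem w s}" using v(2) by auto
  finally have sp: "spans (emb v) (emb b) (emb ` {w. mem w s})" .
  have "emb a \<notin> emb ` {w. mem w s}" using Suc.prems(3) by auto
  then show ?case using spans.step[OF adjacent_emb[OF v(1)] sp] by simp
qed

text \<open>The induction for \<open>search2\<close> removes the first path from its start, so that
  only its last vertex \<open>a\<close> is left when the search for the second path begins and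
  \<open>d\<close> is released.\<close>

lemma search2_last:
  assumes "search1 (Suc m) c d (upd d True s)" "card {v. mem v s} = m" "\<not> mem a s" "\<not> mem c s" "\<not> mem d s"
    "distinct [a, c, d]"
  shows "two_paths (emb ` ({a, c, d} \<union> {v. mem v s})) (emb a) (emb a) (emb c) (emb d)"
proof -
  have s: "{v. mem v (upd d True s)} = insert d {v. mem v s}" by (auto simp: mem_upd)
  have "card {v. mem v (upd d True s)} = Suc m" unfolding s using assms by simp
  moreover have "\<not> mem c (upd d True s)" using assms by (simp add: mem_upd)
  ultimately have "spans (emb c) (emb d) (emb ` insert c (insert d {v. mem v s}))"
    using search1_sound[OF assms(1)] s by metis
  then show ?thesis
    by (rule two_pathsI[OF spans.single]) (use assms(3-6) in auto)
qed

lemma search2_sound: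
  "search2 m a b c d s \<Longrightarrow> card {v. mem v s} = m \<Longrightarrow> \<not> mem a s \<Longrightarrow> \<not> mem c s \<Longrightarrow> \<not> mem d s \<Longrightarrow>
     distinct [a, c, d] \<Longrightarrow>
     two_paths (emb ` ({a, c, d} \<union> {v. mem v s})) (emb a) (emb b) (emb c) (emb d)"
proof (induction m arbitrary: a s)
  case 0
  then show ?case using search2_last[of 0] by (auto split: if_splits)
next
  case (Suc m)
  show ?case
  proof (cases "a = b")
    case True
    then show ?thesis using Suc.prems search2_last[of "Suc m"] by auto
  next
    case False
    with Suc.prems obtain v where v: "v \<in> set (nbrs a)" "mem v s" "search2 m v b c d (upd v False s)"
      by (auto simp: search2s_iff)
    have s: "{w. mem w (upd v False s)} = {w. mem w s} - {v}" by (auto simp: mem_upd)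
    have "card {w. mem w (upd v False s)} = m" unfolding s using v(2) Suc.prems(2) by simp
    moreover have "\<not> mem v (upd v False s)" "\<not> mem c (upd v False s)" "\<not> mem d (upd v False s)"
      using Suc.prems by (simp_all add: mem_upd)
    moreover have "distinct [v, c, d]" using v(2) Suc.prems by auto
    ultimately have "two_paths (emb ` ({v, c, d} \<union> ({w. mem w s} - {v}))) (emb v) (emb b) (emb c) (emb d)"
      using Suc.IH[OF v(3)] s by metis
    also have "{v, c, d} \<union> ({w. mem w s} - {v}) = {c, d} \<union> {w. mem w s}" using v(2) by auto
    finally have P: "two_paths (emb ` ({c, d} \<union> {w. mem w s})) (emb v) (emb b) (emb c) (emb d)" .
    have "emb a \<notin> emb ` ({c, d} \<union> {w. mem w s})" using Suc.prems by auto
    from two_paths_extend[OF P adjacent_emb[OF v(1)] this] show ?thesis by simp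
  qed
qed

lemma card_without: "distinct vs \<Longrightarrow> card {v. mem v (without vs)} = 16 - length vs"
proof -
  assume "distinct vs"
  have "(UNIV :: code set) = set ([X0, X1, X2, X3, X4, X5, X6, X7, X8, X9, XA, XB, XC, XD, XE, XF])"
    using code.exhaust by auto
  moreover have "card (set [X0, X1, X2, X3, X4, X5, X6, X7, X8, X9, XA, XB, XC, XD, XE, XF]) = 16" by simp
  ultimately have "card (UNIV :: code set) = 16" by metis
  moreover have "{v. mem v (without vs)} = UNIV - set vs" by (auto simp: mem_without)
  ultimately show ?thesis using \<open>distinct vs\<close> by (simp add: card_Diff_subset distinct_card)
qed

lemma search1_without:
  assumes "search1 m a b (without (F @ [a]))" "distinct (F @ [a])" "m + length F = 15"
  shows "spans (emb a) (emb b) (subcube x (set I) - emb ` set F)"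
proof -
  have "spans (emb a) (emb b) (emb ` insert a {v. mem v (without (F @ [a]))})"
    using search1_sound[OF assms(1)] card_without[OF assms(2)] assms(3) by (simp add: mem_without)
  also have "emb ` insert a {v. mem v (without (F @ [a]))} = range emb - emb ` set F"
    using assms(2) by (auto simp: mem_without)
  finally show ?thesis by (simp add: range_emb)
qed

text \<open>Besides \<open>F\<close>, the starts \<open>a\<close> and \<open>c\<close> and the
  reserved end \<open>d\<close> are not free, hence \<open>13 = 16 - 3\<close>; in
  \<open>search1_without\<close> this concerns only \<open>a\<close>.\<close>

lemma search2_without:
  assumes "search2 m a b c d (without (F @ [a, c, d]))" "distinct (F @ [a, c, d])" "m + length F = 13"
  shows "two_paths (subcube x (set I) - emb ` set F) (emb a) (emb b) (emb c) (emb d)"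
proof -
  have "two_paths (emb ` ({a, c, d} \<union> {v. mem v (without (F @ [a, c, d]))})) (emb a) (emb b) (emb c) (emb d)"
    using search2_sound[OF assms(1)] card_without[OF assms(2)] assms(2,3) by (simp add: mem_without)
  also have "emb ` ({a, c, d} \<union> {v. mem v (without (F @ [a, c, d]))}) = range emb - emb ` set F"
    using assms(2) by (auto simp: mem_without)
  finally show ?thesis by (simp add: range_emb)
qed

end

text \<open>The coordinates in which \<open>x\<close> and \<open>y\<close> differ are put first. The
  bits of \<open>y\<close> are then a block of ones followed by zeros, so that its code depends only
  on the distance from \<open>x\<close>.\<close>

lemma obtain_frame:
  assumes "cube 4 V" "x \<in> V" "y \<in> V"
  obtains I v where "frame x I" "V = subcube x (set I)" "y = decode x I v"
    "v \<in> {X0, X1, X3, X7, XF}"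
proof -
  obtain x' D where D: "D \<subseteq> {..<length x'}" "card D = 4" "V = subcube x' D"
    using assms(1) unfolding cube_def by blast
  have V: "V = subcube x D" using D(3) assms(2) subcube_rebase by auto
  have D': "D \<subseteq> {..<length x}" using D assms(2) subcube_length by auto
  have fin: "finite D" using D(1) by (meson finite_lessThan finite_subset)
  define K where "K = {i \<in> D. y ! i \<noteq> x ! i}"
  have finK: "finite K" "K \<subseteq> D" using fin by (auto simp: K_def)
  obtain ks where ks: "set ks = K" "distinct ks" using finite_distinct_list[OF finK(1)] by auto
  obtain ls where ls: "set ls = D - K" "distinct ls" using finite_distinct_list[of "D - K"] fin by auto
  have set: "set (ks @ ls) = D" "distinct (ks @ ls)" using ks ls finK by auto
  then have len: "length (ks @ ls) = 4" using D(2) distinct_card by metis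
  interpret frame x "ks @ ls"
    using set len D' by unfold_locales simp_all
  obtain v where v: "y = emb v"
    using emb_cases assms(3) V set(1) by metis
  have "map (\<lambda>i. y ! i \<noteq> x ! i) ks = replicate (length ks) True"
    "map (\<lambda>i. y ! i \<noteq> x ! i) ls = replicate (length ls) False"
    using ks(1) ls(1) by (auto simp: K_def map_replicate_const[symmetric] simp del: map_replicate_const)
  then have "bits v = replicate (length ks) True @ replicate (length ls) False"
    by (subst emb_bits[of v, symmetric]) (simp add: v)
  moreover have "length ls = 4 - length ks" using len by simp
  ultimately have "bits v = replicate (length ks) True @ replicate (4 - length ks) False" by simp
  moreover have "length ks \<le> 4" using len by simp
  then have "length ks \<in> {0, 1, 2, 3, 4}" 
    unfolding insert_iff empty_iff by linarith
  ultimately have "v \<in> {X0, X1, X3, X7, XF}"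
    by (cases v) (auto simp: numeral_eq_Suc)
  then show ?thesis using that[of "ks @ ls" v] frame_axioms V set(1) v by simp
qed

lemma (in frame) code_of_cls:
  "red (emb v) = red x \<Longrightarrow> v \<noteq> X0 \<Longrightarrow> v \<in> set evens" "red (emb v) = (\<not> red x) \<Longrightarrow> v \<in> set odds"
  using red_emb[of v] code_cases[of v] by auto

lemma NN_rg_4: "NN_rg 4"
  unfolding NN_rg_def
proof (intro allI impI)
  fix V k r g p q s t
  assume H: "cube 4 V" "{r, p, q} \<subseteq> cls V k" "{g, s, t} \<subseteq> cls V (\<not> k)" "distinct [r, p, q]" "distinct [g, s, t]"
  obtain I g' where f: "frame r I" "V = subcube r (set I)" "g = decode r I g'" "g' \<in> {X0, X1, X3, X7, XF}"
    using obtain_frame[OF H(1), of r g] H by auto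
  interpret frame r I by (rule f(1))
  have "p \<in> subcube r (set I)" "q \<in> subcube r (set I)" "s \<in> subcube r (set I)" "t \<in> subcube r (set I)"
    using H f(2) by auto
  then obtain p' q' s' t' where e: "p = emb p'" "q = emb q'" "s = emb s'" "t = emb t'"
    by (metis emb_cases)
  have k: "red r = k" "red (emb p') = red r" "red (emb q') = red r" "red (emb s') = (\<not> red r)"
    "red (emb t') = (\<not> red r)" "red (emb g') = (\<not> red r)" "p' \<noteq> X0" "q' \<noteq> X0"
    using H(2-4) f(3) emb_X0 unfolding e by auto
  have cl: "p' \<in> set evens" "q' \<in> set evens" "s' \<in> set odds" "t' \<in> set odds" "g' \<in> set odds"
    using k code_of_cls by auto
  then have g': "g' \<in> set [X1, X7]" using f(4) by (auto simp: odds_def)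
  have ne: "p' \<noteq> q'" "s' \<noteq> t'" "g' \<noteq> s'" "g' \<noteq> t'" using H(4,5) f(3) unfolding e by auto
  have X0: "X0 \<notin> set odds" "set evens \<inter> set odds = {}" by (auto simp: odds_def evens_def)
  \<comment> \<open>Stated for arbitrary codes, because the check may have tested \<open>p'\<close>
    and \<open>q'\<close> in the opposite order, that is, with the two paths exchanged.\<close>
  have P: "two_paths (V - {r, g}) (emb p') (emb s') (emb q') (emb t')"
    if "list_all (\<lambda>s. list_all (\<lambda>t. s = t \<or> search2 11 p' s q' t (without [X0, g', p', q', t]))
      (removeAll g' odds)) (removeAll g' odds)" "{p', q'} \<subseteq> set evens" "p' \<noteq> X0" "q' \<noteq> X0" "p' \<noteq> q'"
      "{s', t'} \<subseteq> set odds" "s' \<noteq> t'" "g' \<noteq> s'" "g' \<noteq> t'" for p' q' s' t'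
  proof -
    have "search2 11 p' s' q' t' (without ([X0, g'] @ [p', q', t']))"
      using that unfolding list_all_iff set_removeAll append.simps by blast
    moreover have "distinct ([X0, g'] @ [p', q', t'])"
      using that X0 cl(5) by auto
    ultimately show ?thesis
      using search2_without[of 11 p' s' q' t' "[X0, g']"] f(2,3) emb_X0 by simp
  qed
  from NN_rg_check g' have "all_pairs (\<lambda>p q. list_all (\<lambda>s. list_all (\<lambda>t.
      s = t \<or> search2 11 p s q t (without [X0, g', p, q, t])) (removeAll g' odds)) (removeAll g' odds)) evens"
    unfolding list_all_iff by blast
  from all_pairs_dest[OF this cl(1,2) ne(1)] show "two_paths (V - {r, g}) p s q t"
    unfolding e using P[of p' q' s' t'] P[of q' p' t' s'] two_paths_swap cl k(7,8) ne by auto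
qed

lemma GG_rr_4: "GG_rr 4"
  unfolding GG_rr_def
proof (intro allI impI)
  fix V k r1 r2 a b c d
  assume H: "cube 4 V" "{r1, r2} \<subseteq> cls V k" "{a, b, c, d} \<subseteq> cls V (\<not> k)" "r1 \<noteq> r2" "distinct [a, b, c, d]"
  obtain I r' where f: "frame r1 I" "V = subcube r1 (set I)" "r2 = decode r1 I r'" "r' \<in> {X0, X1, X3, X7, XF}"
    using obtain_frame[OF H(1), of r1 r2] H by auto
  interpret frame r1 I by (rule f(1))
  have "a \<in> subcube r1 (set I)" "b \<in> subcube r1 (set I)" "c \<in> subcube r1 (set I)" "d \<in> subcube r1 (set I)"
    using H f(2) by auto
  then obtain a' b' c' d' where e: "a = emb a'" "b = emb b'" "c = emb c'" "d = emb d'"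
    by (metis emb_cases)
  have k: "red r1 = k" "red (emb r') = red r1" "red (emb a') = (\<not> red r1)" "red (emb b') = (\<not> red r1)"
    "red (emb c') = (\<not> red r1)" "red (emb d') = (\<not> red r1)" "r' \<noteq> X0"
    using H(2-4) f(3) emb_X0 unfolding e by auto
  have cl: "r' \<in> set evens" "a' \<in> set odds" "b' \<in> set odds" "c' \<in> set odds" "d' \<in> set odds"
    using k code_of_cls by auto
  then have r': "r' \<in> set [X3, XF]" using f(4) by (auto simp: evens_def)
  have ne: "distinct [a', b', c', d']" using H(5) unfolding e by auto
  have X0: "X0 \<notin> set odds" "set evens \<inter> set odds = {}" by (auto simp: odds_def evens_def)
  have P: "two_paths (V - {r1, r2}) (emb a') (emb b') (emb c') (emb d')"
    if "search2 11 a' b' c' d' (without [X0, r', a', c', d'])" "{a', b', c', d'} \<subseteq> set odds"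
      "distinct [a', b', c', d']" for a' b' c' d'
  proof -
    have "distinct ([X0, r'] @ [a', c', d'])"
      using that X0 cl(1) k(7) by auto
    then show ?thesis
      using search2_without[of 11 a' b' c' d' "[X0, r']"] that f(2,3) emb_X0 by simp
  qed
  have Q: "two_paths (V - {r1, r2}) (emb a') (emb b') (emb c') (emb d')"
    if *: "all_pairs (\<lambda>c d. search2 11 a' b' c d (without [X0, r', a', c, d])) (removeAll a' (removeAll b' odds))"
      and odd: "{a', b', c', d'} \<subseteq> set odds" and dist: "distinct [a', b', c', d']" for a' b' c' d'
    using all_pairs_dest[OF *, of c' d'] P[of a' b' c' d'] P[of a' b' d' c'] two_paths_rev2 odd dist by auto
  from GG_rr_check r' have "all_pairs (\<lambda>a b. all_pairs (\<lambda>c d.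
       search2 11 a b c d (without [X0, r', a, c, d])) (removeAll a (removeAll b odds))) odds"
    unfolding list_all_iff by blast
  from all_pairs_dest[OF this cl(2,3)] show "two_paths (V - {r1, r2}) a b c d"
    unfolding e using Q[of a' b' c' d'] Q[of b' a' c' d'] two_paths_rev cl ne by auto
qed

lemma G_rrg_4: "G_rrg 4"
  unfolding G_rrg_def
proof (intro allI impI)
  fix V k r1 r2 g a b
  assume H: "cube 4 V" "{r1, r2} \<subseteq> cls V k" "{g, a, b} \<subseteq> cls V (\<not> k)" "r1 \<noteq> r2" "distinct [g, a, b]"
  obtain I r' where f: "frame r1 I" "V = subcube r1 (set I)" "r2 = decode r1 I r'" "r' \<in> {X0, X1, X3, X7, XF}"
    using obtain_frame[OF H(1), of r1 r2] H by auto
  interpret frame r1 I by (rule f(1))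
  have "a \<in> subcube r1 (set I)" "b \<in> subcube r1 (set I)" "g \<in> subcube r1 (set I)"
    using H f(2) by auto
  then obtain a' b' g' where e: "a = emb a'" "b = emb b'" "g = emb g'"
    by (metis emb_cases)
  have k: "red r1 = k" "red (emb r') = red r1" "red (emb a') = (\<not> red r1)" "red (emb b') = (\<not> red r1)"
    "red (emb g') = (\<not> red r1)" "r' \<noteq> X0"
    using H(2-4) f(3) emb_X0 unfolding e by auto
  have cl: "r' \<in> set evens" "a' \<in> set odds" "b' \<in> set odds" "g' \<in> set odds"
    using k code_of_cls by auto
  then have r': "r' \<in> set [X3, XF]" using f(4) by (auto simp: evens_def)
  have ne: "distinct [g', a', b']" using H(5) unfolding e by auto
  have X0: "X0 \<notin> set odds" "set evens \<inter> set odds = {}" by (auto simp: odds_def evens_def)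
  have P: "spans (emb a') (emb b') (V - {r1, r2, g})"
    if "search1 12 a' b' (without [X0, r', g', a'])" "{a', b'} \<subseteq> set odds" "distinct [g', a', b']" for a' b'
  proof -
    have "distinct ([X0, r', g'] @ [a'])"
      using that X0 cl(1,4) k(6) by auto
    then show ?thesis
      using search1_without[of 12 a' b' "[X0, r', g']"] that f(2,3) e(3) emb_X0 by simp
  qed
  from G_rrg_check r' cl(4) have "all_pairs (\<lambda>a b. search1 12 a b (without [X0, r', g', a])) (removeAll g' odds)"
    unfolding list_all_iff by blast
  from all_pairs_dest[OF this, of a' b'] show "spans a b (V - {r1, r2, g})"
    unfolding e(1,2) using P[of a' b'] P[of b' a'] spans_sym cl ne by auto
qed

lemma weak_NG_rrg_4: "weak_NG_rrg 4"
  unfolding weak_NG_rrg_def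
proof (intro allI impI)
  fix V k r1 r2 g s a b x1 x2
  assume H: "cube 4 V" "{r1, r2} \<subseteq> cls V k" "{g, s, a, b} \<subseteq> cls V (\<not> k)" "r1 \<noteq> r2" "distinct [g, s, a, b]"
  obtain I r' where f: "frame r1 I" "V = subcube r1 (set I)" "r2 = decode r1 I r'" "r' \<in> {X0, X1, X3, X7, XF}"
    using obtain_frame[OF H(1), of r1 r2] H by auto
  interpret frame r1 I by (rule f(1))
  have "a \<in> subcube r1 (set I)" "b \<in> subcube r1 (set I)" "g \<in> subcube r1 (set I)" "s \<in> subcube r1 (set I)"
    using H f(2) by auto
  then obtain a' b' g' s' where e: "a = emb a'" "b = emb b'" "g = emb g'" "s = emb s'"
    by (metis emb_cases)
  have k: "red r1 = k" "red (emb r') = red r1" "red (emb a') = (\<not> red r1)" "red (emb b') = (\<not> red r1)"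
    "red (emb g') = (\<not> red r1)" "red (emb s') = (\<not> red r1)" "r' \<noteq> X0"
    using H(2-4) f(3) emb_X0 unfolding e by auto
  have cl: "r' \<in> set evens" "a' \<in> set odds" "b' \<in> set odds" "g' \<in> set odds" "s' \<in> set odds"
    using k code_of_cls by auto
  then have r': "r' = X3 \<or> r' = XF" using f(4) by (auto simp: evens_def)
  have ne: "distinct [g', s', a', b']" using H(5) unfolding e by auto
  have X0: "X0 \<notin> set odds" "X0 \<notin> set evens" "set evens \<inter> set odds = {}" by (auto simp: odds_def evens_def)
  have P: "\<exists>p \<in> cls V k. p \<notin> {r1, r2, x1, x2} \<and> two_paths (V - {r1, r2, g}) p (emb s') (emb a') (emb b')"
    if *: "at_least 3 (\<lambda>p. search2 10 a' b' s' p (without [X0, r', g', a', s', p])) (removeAll r' evens)"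
      and odd: "{a', b', s'} \<subseteq> set odds" and dist: "distinct [g', s', a', b']" for a' b' s'
  proof -
    define G where "G = {p \<in> set (removeAll r' evens). search2 10 a' b' s' p (without [X0, r', g', a', s', p])}"
    have "distinct (removeAll r' evens)" by (simp add: distinct_removeAll evens_def)
    then have "3 \<le> card G" using at_least_card[OF *] by (simp add: G_def)
    then have "3 \<le> card (emb ` G)" by (subst card_image) (auto simp: inj_on_def)
    moreover have "card {x1, x2} < 3" by (simp add: card_insert_if)
    ultimately obtain p where p: "p \<in> G" "emb p \<notin> {x1, x2}"
      by (metis card_mono finite.emptyI finite_insert image_subset_iff le_trans not_le)
    then have pe: "p \<in> set evens" "p \<noteq> r'" "search2 10 a' b' s' p (without [X0, r', g', a', s', p])"
      by (auto simp: G_def)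
    have dist': "distinct ([X0, r', g'] @ [a', s', p])"
      using dist odd pe X0 cl k(7) by auto
    have "two_paths (V - {r1, r2, g}) (emb a') (emb b') (emb s') (emb p)"
      using search2_without[of 10 a' b' s' p "[X0, r', g']"] pe(3) dist' f(2,3) e(3) emb_X0 by simp
    then have "two_paths (V - {r1, r2, g}) (emb p) (emb s') (emb a') (emb b')"
      using two_paths_swap two_paths_rev by blast
    moreover have "emb p \<in> cls V k" using red_emb[of p] pe(1) k(1) f(2) range_emb by auto
    moreover have "emb p \<notin> {r1, r2}" using dist' f(3) emb_X0 emb_inject by (metis append_Cons distinct_length_2_or_more insertE list.set_intros(1) singletonD distinct_append append_Nil)
    ultimately show ?thesis using p(2) by blast
  qed
  have "all_pairs (\<lambda>a b. at_least 3 (\<lambda>p. search2 10 a b s' p (without [X0, r', g', a, s', p])) (removeAll r' evens))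
     (removeAll s' (removeAll g' odds))"
    using r' weak_NG_rrg_check_X3 weak_NG_rrg_check_XF cl(4,5) ne unfolding list_all_iff by auto
  from all_pairs_dest[OF this, of a' b']
  have "(\<exists>p \<in> cls V k. p \<notin> {r1, r2, x1, x2} \<and> two_paths (V - {r1, r2, g}) p s a b) \<or>
    (\<exists>p \<in> cls V k. p \<notin> {r1, r2, x1, x2} \<and> two_paths (V - {r1, r2, g}) p s b a)"
    unfolding e(1,2,4) using P[of a' b' s'] P[of b' a' s'] cl ne by auto
  then show "\<exists>p \<in> cls V k. p \<notin> {r1, r2, x1, x2} \<and> two_paths (V - {r1, r2, g}) p s a b"
    using two_paths_rev2 by blast
qed

lemma cube_facts_4: "cube_facts 4"
  by (simp add: cube_facts_def NN_rg_4 GG_rr_4 G_rrg_4 weak_NG_rrg_4)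

section \<open>Path coverings of faulty hypercubes\<close>

abbreviation vertices :: "nat \<Rightarrow> bool list set" where
  "vertices n \<equiv> {x. length x = n}"

lemma cube_vertices: "cube n (vertices n)"
  unfolding cube_def
  by (intro exI[of _ "replicate n False"] exI[of _ "{..<n}"]) (auto simp: subcube_def)

lemma adjacent_iff_card:
  assumes "length x = n" "length y = n"
  shows "card {i. i < n \<and> x ! i \<noteq> y ! i} = 1 \<longleftrightarrow> adjacent x y"
proof
  assume "card {i. i < n \<and> x ! i \<noteq> y ! i} = 1"
  then obtain i where i: "{i. i < n \<and> x ! i \<noteq> y ! i} = {i}" by (auto simp: card_1_singleton_iff)
  then have "i < n" by blast
  have "y = flip i x"
  proof (rule nth_equalityI)
    fix j assume "j < length y"
    moreover have "j < n \<and> x ! j \<noteq> y ! j \<longleftrightarrow> j = i" using i by (auto simp: set_eq_iff)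
    ultimately show "y ! j = flip i x ! j"
      using assms \<open>i < n\<close> nth_flip[of i x j] by auto
  qed (use assms in simp)
  then show "adjacent x y" using adjacent_flip[of i x] \<open>i < n\<close> assms by simp
next
  assume "adjacent x y"
  then obtain i where "i < n" "y = flip i x" using assms unfolding adjacent_def by auto
  moreover from this have "x ! j \<noteq> y ! j \<longleftrightarrow> j = i" for j using assms by (simp add: nth_flip)
  ultimately have "{i. i < n \<and> x ! i \<noteq> y ! i} = {i}" by auto
  then show "card {i. i < n \<and> x ! i \<noteq> y ! i} = 1" by simp
qed

lemma verts_faulty [simp]: "verts (faulty_hypercube n F) = vertices n - F"
  by (simp add: faulty_hypercube_def hypercube_def)

lemma arcs_ends_faulty:
  "arcs_ends (faulty_hypercube n F) = {(x, y). {x, y} \<subseteq> vertices n - F \<and> adjacent x y}"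
  using adjacent_iff_card
  by (auto simp: faulty_hypercube_def hypercube_def arcs_ends_def arc_to_ends_def image_iff)

lemma vpath_faulty:
  "vpath p (faulty_hypercube n F) \<longleftrightarrow>
     p \<noteq> [] \<and> distinct p \<and> set p \<subseteq> vertices n - F \<and> successively adjacent p"
proof -
  have "set (vwalk_arcs p) \<subseteq> arcs_ends (faulty_hypercube n F) \<longleftrightarrow> successively adjacent p"
    if "set p \<subseteq> vertices n - F"
    using that by (induction p rule: vwalk_arcs.induct) (auto simp: arcs_ends_faulty)
  then show ?thesis by (auto simp: vpath_def vwalk_def)
qed

lemma two_paths_covering:
  assumes "two_paths (vertices n - F) a b c d"
  shows "\<exists>P. path_covering (faulty_hypercube n F) P \<and> path_ends ` P = {{a, b}, {c, d}}"
proof -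
  obtain S T where ST: "spans a b S" "spans c d T" "S \<inter> T = {}" "S \<union> T = vertices n - F"
    using assms by (rule two_pathsE)
  obtain p where p: "p \<noteq> []" "hd p = a" "last p = b" "set p = S" "distinct p" "successively adjacent p"
    using ST(1) by (rule spans_list)
  obtain q where q: "q \<noteq> []" "hd q = c" "last q = d" "set q = T" "distinct q" "successively adjacent q"
    using ST(2) by (rule spans_list)
  have "path_covering (faulty_hypercube n F) {p, q}"
    using p q ST by (auto simp: path_covering_def vpath_faulty pairwise_insert disjnt_def)
  moreover have "path_ends ` {p, q} = {{a, b}, {c, d}}"
    using p q by (simp add: path_ends_def)
  ultimately show ?thesis by blast
qed

lemma green_iff: "green x \<longleftrightarrow> \<not> red x"
  by (simp add: green_def red_def)

lemma pair_kinds: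
  assumes "a \<noteq> b"
  shows "red_pair {a, b} \<longleftrightarrow> red a \<and> red b" "green_pair {a, b} \<longleftrightarrow> \<not> red a \<and> \<not> red b"
    "charged_pair {a, b} \<longleftrightarrow> red a = red b" "neutral_pair {a, b} \<longleftrightarrow> red a \<noteq> red b"
  using assms by (auto simp: red_pair_def green_pair_def charged_pair_def neutral_pair_def green_iff)

lemma card_filter_two:
  "e \<noteq> e' \<Longrightarrow> card {x \<in> {e, e'}. P x} = of_bool (P e) + of_bool (P e')"
proof -
  assume "e \<noteq> e'"
  have "{x \<in> {e, e'}. P x} = (if P e then {e} else {}) \<union> (if P e' then {e'} else {})" by auto
  then show ?thesis using \<open>e \<noteq> e'\<close> by (simp split: if_splits)
qed

text \<open>For two pairs, balance and the kinds of pairs turn into a condition on four colours,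
  which is then settled by case distinction.\<close>

lemma admissible_two:
  assumes "distinct [a, b, c, d]"
  shows "admissible_ends n F N Ch {{a, b}, {c, d}} \<longleftrightarrow>
    {a, b, c, d} \<subseteq> vertices n - F \<and>
    red_minus_green F = of_bool (\<not> red a \<and> \<not> red b) + of_bool (\<not> red c \<and> \<not> red d)
      - of_bool (red a \<and> red b) - of_bool (red c \<and> red d) \<and>
    of_bool (red a \<noteq> red b) + of_bool (red c \<noteq> red d) = N \<and>
    of_bool (red a = red b) + of_bool (red c = red d) = Ch"
proof -
  have ne: "{a, b} \<noteq> {c, d}" "a \<noteq> b" "c \<noteq> d" using assms by auto
  have disj: "disjoint_pairs {{a, b}, {c, d}}"
    using assms by (auto simp: disjoint_pairs_def disjoint_def)
  have Un: "\<Union>{{a, b}, {c, d}} = {a, b, c, d}" by auto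
  show ?thesis
    unfolding admissible_ends_def in_balance_def verts_faulty
      card_filter_two[OF ne(1)] pair_kinds[OF ne(2)] pair_kinds[OF ne(3)]
    by (simp only: disj Un of_nat_add of_nat_of_bool diff_diff_eq simp_thms conj_assoc)
qed

lemma admissible_cases:
  assumes "admissible_ends n F N Ch E" "N + Ch = 2"
  obtains a b c d where "E = {{a, b}, {c, d}}" "distinct [a, b, c, d]"
proof -
  have E: "disjoint E" "\<And>e. e \<in> E \<Longrightarrow> card e = 2" "\<Union>E \<subseteq> vertices n"
    using assms by (auto simp: admissible_ends_def disjoint_pairs_def in_balance_def)
  have "finite (vertices n)" using finite_lists_length_eq[of "UNIV :: bool set" n] by simp
  \<comment> \<open>The given numbers of pairs alone do not bound \<open>E\<close>, as an infinite
    set has cardinality 0.\<close>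
  then have "finite E" using E(3) by (meson finite_UnionD finite_subset)
  have kind: "neutral_pair e \<noteq> charged_pair e" if e: "e \<in> E" for e
  proof -
    obtain u v where "e = {u, v}" "u \<noteq> v" using E(2)[OF e] by (auto simp: card_2_iff)
    then show ?thesis using pair_kinds by auto
  qed
  then have "E = {e \<in> E. neutral_pair e} \<union> {e \<in> E. charged_pair e}"
    "{e \<in> E. neutral_pair e} \<inter> {e \<in> E. charged_pair e} = {}" by auto
  then have "card E = 2"
    using assms \<open>finite E\<close> card_Un_disjoint[of "{e \<in> E. neutral_pair e}" "{e \<in> E. charged_pair e}"]
    by (simp add: admissible_ends_def)
  then obtain e e' where ee: "E = {e, e'}" "e \<noteq> e'" by (auto simp: card_2_iff)
  obtain a b where ab: "e = {a, b}" "a \<noteq> b" using E(2)[of e] ee by (auto simp: card_2_iff)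
  obtain c d where cd: "e' = {c, d}" "c \<noteq> d" using E(2)[of e'] ee by (auto simp: card_2_iff)
  have "e \<inter> e' = {}" using E(1) ee by (auto simp: disjoint_def)
  then show ?thesis using that[of a b c d] ee(1) ab cd by auto
qed

lemma fault_colours:
  assumes "is_fault n F"
  shows "finite F" "F \<subseteq> vertices n" "card (cls F True) + card (cls F False) = mass F"
    "red_minus_green F = int (card (cls F True)) - int (card (cls F False))"
proof -
  show F: "F \<subseteq> vertices n" using assms by (simp add: is_fault_def hypercube_def)
  then show fin: "finite F" using finite_lists_length_eq[of "UNIV :: bool set" n] finite_subset by auto
  have "F = cls F True \<union> cls F False" "cls F True \<inter> cls F False = {}" by auto
  moreover have "finite (cls F k)" for k using fin by (simp add: cls_def)
  ultimately show "card (cls F True) + card (cls F False) = mass F"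
    unfolding mass_def by (metis card_Un_disjoint)
  show "red_minus_green F = int (card (cls F True)) - int (card (cls F False))"
    by (simp add: red_minus_green_def cls_def green_iff)
qed

lemma cls_fault: "is_fault n F \<Longrightarrow> cls F k \<subseteq> cls (vertices n) k"
  using fault_colours(2)[of n F] unfolding cls_def by blast

lemma cls_Un: "F = cls F k \<union> cls F (\<not> k)"
  by auto

section \<open>Upper bounds: prescribing ends from dimension 5 or 4 on\<close>

lemma free_4_2_0_2:
  assumes "5 \<le> n" "is_fault n F" "mass F = 4" "charge F = 2"
  shows "can_freely_prescribe_ends n F 0 2"
proof -
  \<comment> \<open>Mass 4 and charge 2 mean three deleted vertices of one colour and one of the
    other. With \<open>k\<close> as the colour of the majority, balance forces all four ends to have
    the other colour.\<close>
  obtain k where k: "card (cls F k) = 3" "card (cls F (\<not> k)) = 1"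
    "red_minus_green F = (if k then 2 else - 2)"
  proof -
    have "card (cls F True) = 3 \<and> card (cls F False) = 1 \<or> card (cls F True) = 1 \<and> card (cls F False) = 3"
      using fault_colours[OF assms(2)] assms(3,4) by (auto simp: charge_def)
    then show ?thesis using that[of True] that[of False] fault_colours(4)[OF assms(2)] by auto
  qed
  obtain r1 r2 r3 g where r: "cls F k = {r1, r2, r3}" "distinct [r1, r2, r3]" "cls F (\<not> k) = {g}"
    using k(1,2) by (auto simp: card_3_iff card_1_singleton_iff)
  have F: "F = {r1, r2, r3, g}" using cls_Un[of F k] r by auto
  have FV: "{r1, r2, r3} \<subseteq> cls (vertices n) k" "g \<in> cls (vertices n) (\<not> k)"
    using cls_fault[OF assms(2), of k] cls_fault[OF assms(2), of "\<not> k"] unfolding r by auto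
  have n: "4 \<le> n" using assms(1) by simp
  have cover: "two_paths (vertices n - F) a b c d"
    if "{a, b, c, d} \<subseteq> cls (vertices n) (\<not> k)" "distinct [g, a, b, c, d]" for a b c d
    unfolding F using that FV r(2)
    by (intro GG_rrrgD[OF GG_rrrg_all[OF cube_facts_4 assms(1)] cube_vertices, of _ _ _ k]) auto
  show ?thesis
    unfolding can_freely_prescribe_ends_def
  proof
    obtain a where a: "a \<in> vertices n" "red a = (\<not> k)" "a \<notin> set [g]"
      by (rule pick_vertex[OF cube_vertices n, of "[g]" "\<not> k"]) auto
    obtain b where b: "b \<in> vertices n" "red b = (\<not> k)" "b \<notin> set [g, a]"
      by (rule pick_vertex[OF cube_vertices n, of "[g, a]" "\<not> k"]) auto
    obtain c where c: "c \<in> vertices n" "red c = (\<not> k)" "c \<notin> set [g, a, b]"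
      by (rule pick_vertex[OF cube_vertices n, of "[g, a, b]" "\<not> k"]) auto
    obtain d where d: "d \<in> vertices n" "red d = (\<not> k)" "d \<notin> set [g, a, b, c]"
      by (rule pick_vertex[OF cube_vertices n, of "[g, a, b, c]" "\<not> k"]) auto
    have "admissible_ends n F 0 2 {{a, b}, {c, d}}"
      by (subst admissible_two) (use a b c d k(3) FV F in auto)
    then show "\<exists>E. admissible_ends n F 0 2 E" by blast
    show "\<forall>E. admissible_ends n F 0 2 E \<longrightarrow>
        (\<exists>P. path_covering (faulty_hypercube n F) P \<and> path_ends ` P = E)"
    proof (intro allI impI)
      fix E assume E: "admissible_ends n F 0 2 E"
      then obtain a b c d where e: "E = {{a, b}, {c, d}}" "distinct [a, b, c, d]"
        by (rule admissible_cases) simp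
      then have *: "{a, b, c, d} \<subseteq> vertices n - F"
        "(if k then 2 else - 2 :: int) = of_bool (\<not> red a \<and> \<not> red b) + of_bool (\<not> red c \<and> \<not> red d)
          - of_bool (red a \<and> red b) - of_bool (red c \<and> red d)"
        "of_bool (red a \<noteq> red b) + of_bool (red c \<noteq> red d) = (0 :: nat)"
        using E k(3) admissible_two[OF e(2)] by auto
      then have "red a = (\<not> k)" "red b = (\<not> k)" "red c = (\<not> k)" "red d = (\<not> k)"
        by (cases k; cases "red a"; cases "red b"; cases "red c"; cases "red d"; simp)+
      then have "two_paths (vertices n - F) a b c d"
        using * e(2) F by (intro cover) auto
      then show "\<exists>P. path_covering (faulty_hypercube n F) P \<and> path_ends ` P = E"
        unfolding e(1) by (rule two_paths_covering)
    qed
  qed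
qed

lemma free_3_1_1_1:
  assumes "5 \<le> n" "is_fault n F" "mass F = 3" "charge F = 1"
  shows "can_freely_prescribe_ends n F 1 1"
proof -
  obtain k where k: "card (cls F k) = 2" "card (cls F (\<not> k)) = 1"
    "red_minus_green F = (if k then 1 else - 1)"
  proof -
    have "card (cls F True) = 2 \<and> card (cls F False) = 1 \<or> card (cls F True) = 1 \<and> card (cls F False) = 2"
      using fault_colours[OF assms(2)] assms(3,4) by (auto simp: charge_def)
    then show ?thesis using that[of True] that[of False] fault_colours(4)[OF assms(2)] by auto
  qed
  obtain r1 r2 g where r: "cls F k = {r1, r2}" "r1 \<noteq> r2" "cls F (\<not> k) = {g}"
    using k(1,2) by (auto simp: card_2_iff card_1_singleton_iff)
  have F: "F = {r1, r2, g}" using cls_Un[of F k] r by auto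
  have FV: "{r1, r2} \<subseteq> cls (vertices n) k" "g \<in> cls (vertices n) (\<not> k)"
    using cls_fault[OF assms(2), of k] cls_fault[OF assms(2), of "\<not> k"] unfolding r by auto
  have n: "4 \<le> n" using assms(1) by simp
  have cover: "two_paths (vertices n - F) p s a b"
    if "p \<in> cls (vertices n) k" "{s, a, b} \<subseteq> cls (vertices n) (\<not> k)" "distinct [r1, r2, p]"
      "distinct [g, s, a, b]" for p s a b
    unfolding F using that FV
    by (intro NG_rrgD[OF NG_rrg_of_GG_rrrg[OF GG_rrrg_all[OF cube_facts_4 assms(1)] assms(1)] cube_vertices, of _ _ _ k]) auto
  show ?thesis
    unfolding can_freely_prescribe_ends_def
  proof
    obtain p where p: "p \<in> vertices n" "red p = k" "p \<notin> set [r1, r2]"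
      by (rule pick_vertex[OF cube_vertices n, of "[r1, r2]" k]) auto
    obtain s where s: "s \<in> vertices n" "red s = (\<not> k)" "s \<notin> set [g]"
      by (rule pick_vertex[OF cube_vertices n, of "[g]" "\<not> k"]) auto
    obtain a where a: "a \<in> vertices n" "red a = (\<not> k)" "a \<notin> set [g, s]"
      by (rule pick_vertex[OF cube_vertices n, of "[g, s]" "\<not> k"]) auto
    obtain b where b: "b \<in> vertices n" "red b = (\<not> k)" "b \<notin> set [g, s, a]"
      by (rule pick_vertex[OF cube_vertices n, of "[g, s, a]" "\<not> k"]) auto
    have "admissible_ends n F 1 1 {{p, s}, {a, b}}"
      by (subst admissible_two) (use p s a b k(3) FV F in auto)
    then show "\<exists>E. admissible_ends n F 1 1 E" by blast
    show "\<forall>E. admissible_ends n F 1 1 E \<longrightarrow>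
        (\<exists>P. path_covering (faulty_hypercube n F) P \<and> path_ends ` P = E)"
    proof (intro allI impI)
      fix E assume E: "admissible_ends n F 1 1 E"
      then obtain a b c d where e: "E = {{a, b}, {c, d}}" "distinct [a, b, c, d]"
        by (rule admissible_cases) simp
      then have *: "{a, b, c, d} \<subseteq> vertices n - F"
        "(if k then 1 else - 1 :: int) = of_bool (\<not> red a \<and> \<not> red b) + of_bool (\<not> red c \<and> \<not> red d)
          - of_bool (red a \<and> red b) - of_bool (red c \<and> red d)"
        "of_bool (red a \<noteq> red b) + of_bool (red c \<noteq> red d) = (1 :: nat)"
        using E k(3) admissible_two[OF e(2)] by auto
      \<comment> \<open>Balance forces the charged pair to have colour \<open>\<not> k\<close>, so
        that exactly one of the four ends has colour \<open>k\<close>.\<close>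
      then consider "red a = k" "red b = (\<not> k)" "red c = (\<not> k)" "red d = (\<not> k)"
        | "red a = (\<not> k)" "red b = k" "red c = (\<not> k)" "red d = (\<not> k)"
        | "red a = (\<not> k)" "red b = (\<not> k)" "red c = k" "red d = (\<not> k)"
        | "red a = (\<not> k)" "red b = (\<not> k)" "red c = (\<not> k)" "red d = k"
        by (cases k; cases "red a"; cases "red b"; cases "red c"; cases "red d"; simp)
      then have "two_paths (vertices n - F) a b c d"
      proof cases
        case 1
        then show ?thesis using * e(2) F r(2) by (intro cover) auto
      next
        case 2
        then show ?thesis using * e(2) F r(2) by (intro two_paths_rev[OF cover]) auto
      next
        case 3
        then show ?thesis using * e(2) F r(2) by (intro two_paths_swap[OF cover]) auto
      next
        case 4
        then show ?thesis using * e(2) F r(2) by (intro two_paths_swap[OF two_paths_rev[OF cover]]) auto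
      qed
      then show "\<exists>P. path_covering (faulty_hypercube n F) P \<and> path_ends ` P = E"
        unfolding e(1) by (rule two_paths_covering)
    qed
  qed
qed

lemma cube_facts_ge_4: "4 \<le> n \<Longrightarrow> cube_facts n"
  using cube_facts_4 cube_facts_of_GG_rrrg[OF GG_rrrg_all[OF cube_facts_4]] by (cases "n = 4") auto

lemma free_2_0_2_0:
  assumes n: "4 \<le> n" and "is_fault n F" "mass F = 2" "charge F = 0"
  shows "can_freely_prescribe_ends n F 2 0"
proof -
  have k: "card (cls F True) = 1" "card (cls F False) = 1" "red_minus_green F = 0"
    using fault_colours[OF assms(2)] assms(3,4) by (auto simp: charge_def)
  obtain r g where r: "cls F True = {r}" "cls F False = {g}"
    using k(1,2) by (auto simp: card_1_singleton_iff)
  have F: "F = {r, g}" using cls_Un[of F True] r by auto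
  have FV: "r \<in> cls (vertices n) True" "g \<in> cls (vertices n) False"
    using cls_fault[OF assms(2), of True] cls_fault[OF assms(2), of False] unfolding r by auto
  have cover: "two_paths (vertices n - F) p s q t"
    if "{p, q} \<subseteq> cls (vertices n) True" "{s, t} \<subseteq> cls (vertices n) False" "distinct [r, p, q]"
      "distinct [g, s, t]" for p s q t
    unfolding F using that FV cube_facts_ge_4[OF n]
    by (intro NN_rgD[of n _ _ _ _ True, OF _ cube_vertices]) (auto simp: cube_facts_def)
  show ?thesis
    unfolding can_freely_prescribe_ends_def
  proof
    obtain p where p: "p \<in> vertices n" "red p = True" "p \<notin> set [r]"
      by (rule pick_vertex[OF cube_vertices n, of "[r]" True]) auto
    obtain q where q: "q \<in> vertices n" "red q = True" "q \<notin> set [r, p]"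
      by (rule pick_vertex[OF cube_vertices n, of "[r, p]" True]) auto
    obtain s where s: "s \<in> vertices n" "red s = False" "s \<notin> set [g]"
      by (rule pick_vertex[OF cube_vertices n, of "[g]" False]) auto
    obtain t where t: "t \<in> vertices n" "red t = False" "t \<notin> set [g, s]"
      by (rule pick_vertex[OF cube_vertices n, of "[g, s]" False]) auto
    have "admissible_ends n F 2 0 {{p, s}, {q, t}}"
      by (subst admissible_two) (use p q s t k(3) FV F in auto)
    then show "\<exists>E. admissible_ends n F 2 0 E" by blast
    show "\<forall>E. admissible_ends n F 2 0 E \<longrightarrow>
        (\<exists>P. path_covering (faulty_hypercube n F) P \<and> path_ends ` P = E)"
    proof (intro allI impI)
      fix E assume E: "admissible_ends n F 2 0 E"
      then obtain a b c d where e: "E = {{a, b}, {c, d}}" "distinct [a, b, c, d]"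
        by (rule admissible_cases) simp
      then have *: "{a, b, c, d} \<subseteq> vertices n - F" "red a \<noteq> red b" "red c \<noteq> red d"
        using E admissible_two[OF e(2)] by auto
      then consider "red a" "\<not> red b" "red c" "\<not> red d" | "\<not> red a" "red b" "red c" "\<not> red d"
        | "red a" "\<not> red b" "\<not> red c" "red d" | "\<not> red a" "red b" "\<not> red c" "red d" by blast
      then have "two_paths (vertices n - F) a b c d"
      proof cases
        case 1
        then show ?thesis using * e(2) F by (intro cover) auto
      next
        case 2
        then show ?thesis using * e(2) F by (intro two_paths_rev[OF cover]) auto
      next
        case 3
        then show ?thesis using * e(2) F by (intro two_paths_rev2[OF cover]) auto
      next
        case 4
        then show ?thesis using * e(2) F by (intro two_paths_rev[OF two_paths_rev2[OF cover]]) auto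
      qed
      then show "\<exists>P. path_covering (faulty_hypercube n F) P \<and> path_ends ` P = E"
        unfolding e(1) by (rule two_paths_covering)
    qed
  qed
qed

section \<open>Lower bounds: faults that admit no covering one dimension below\<close>

lemma inner_neighbours:
  assumes "successively adjacent p" "distinct p" "v \<in> set p" "v \<notin> path_ends p"
  obtains u w where "{u, w} \<subseteq> set p" "u \<noteq> w" "adjacent v u" "adjacent v w"
proof -
  obtain xs ys where p: "p = xs @ v # ys" using split_list[OF assms(3)] by blast
  have "xs \<noteq> []" "ys \<noteq> []" using assms(4) by (auto simp: p path_ends_def)
  then show ?thesis
    using that[of "last xs" "hd ys"] assms(1,2) adjacent_sym
    by (cases ys; cases xs rule: rev_cases) (auto simp: p successively_append_iff successively_Cons)
qed

lemma covering_inner: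
  assumes "path_covering (faulty_hypercube n F) P" "v \<in> vertices n - F" "v \<notin> \<Union>(path_ends ` P)"
  obtains p u w where "p \<in> P" "v \<in> set p" "{u, w} \<subseteq> set p - F" "u \<noteq> w" "adjacent v u" "adjacent v w"
proof -
  obtain p where p: "p \<in> P" "v \<in> set p"
    using assms(1,2) by (auto simp: path_covering_def)
  then have "vpath p (faulty_hypercube n F)" using assms(1) by (simp add: path_covering_def)
  then have *: "successively adjacent p" "distinct p" "set p \<subseteq> vertices n - F" by (auto simp: vpath_faulty)
  have "v \<notin> path_ends p" using assms(3) p(1) by blast
  then obtain u w where "{u, w} \<subseteq> set p" "u \<noteq> w" "adjacent v u" "adjacent v w"
    by (rule inner_neighbours[OF *(1,2) p(2)])
  then show ?thesis using that[OF p, of u w] *(3) by blast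
qed

text \<open>The paths are disjoint, so a prescribed end that lies on \<open>p\<close> reveals which
  pair belongs to \<open>p\<close>.\<close>

lemma covering_ends:
  assumes "path_covering (faulty_hypercube n F) P" "p \<in> P" "e \<in> path_ends ` P" "z \<in> e" "z \<in> set p"
  shows "path_ends p = e"
proof -
  obtain q where q: "q \<in> P" "e = path_ends q" using assms(3) by blast
  have "q \<noteq> []" using assms(1) q(1) by (auto simp: path_covering_def vpath_faulty)
  then have "z \<in> set q" using assms(4) q(2) by (auto simp: path_ends_def)
  then have "p = q"
    using assms(1,2,5) q(1) unfolding path_covering_def pairwise_def disjnt_def by blast
  then show ?thesis using q by simp
qed

lemma adjacent_iff_upt:
  "adjacent v w \<longleftrightarrow> (\<exists>i \<in> set [0..<length v]. w = flip i v)"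
  by (auto simp: adjacent_def)

text \<open>Three of the four neighbours of \<open>v\<close> are deleted, so that \<open>v\<close>
  cannot be an inner vertex of a path, and it is not prescribed as an end.\<close>

lemma not_free_4_2_0_2:
  "\<exists>F. is_fault 4 F \<and> mass F = 4 \<and> charge F = 2 \<and> \<not> can_freely_prescribe_ends 4 F 0 2"
proof -
  define v where "v = [True, False, False, False]"
  define F where "F = {[False, False, False, False], [True, True, False, False], [True, False, True, False],
    [False, True, False, False]}"
  define E where "E = {{[False, False, True, False], [False, False, False, True]},
    {[True, True, True, False], [True, True, False, True]}}"
  have "cls F True = {[False, False, False, False], [True, True, False, False], [True, False, True, False]}"
    "cls F False = {[False, True, False, False]}"
    by (auto simp: F_def cls_def red_def)
  moreover have "is_fault 4 F" by (simp add: is_fault_def hypercube_def F_def)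
  ultimately have F: "is_fault 4 F" "mass F = 4" "red_minus_green F = 2"
    using fault_colours(3,4)[of 4 F] by simp_all
  have "admissible_ends 4 F 0 2 E"
    unfolding E_def by (subst admissible_two) (use F(3) in \<open>auto simp: F_def red_def\<close>)
  moreover have "\<not> (path_covering (faulty_hypercube 4 F) P \<and> path_ends ` P = E)" for P
  proof
    assume P: "path_covering (faulty_hypercube 4 F) P \<and> path_ends ` P = E"
    have v: "v \<in> vertices 4 - F" "v \<notin> \<Union>(path_ends ` P)"
      using P by (simp_all add: v_def F_def E_def)
    obtain p u w where p: "p \<in> P" "{u, w} \<subseteq> set p - F" "u \<noteq> w" "adjacent v u" "adjacent v w"
      by (rule covering_inner[OF conjunct1[OF P] v])
    have "z \<in> F \<union> {[True, False, False, True]}" if "adjacent v z" for z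
      using that by (simp add: adjacent_iff_upt flip_def F_def v_def) blast
    from this[OF p(4)] this[OF p(5)] show False using p(2,3) by blast
  qed
  ultimately show ?thesis
    using F by (intro exI[of _ F]) (auto simp: charge_def can_freely_prescribe_ends_def)
qed

text \<open>Only the neighbours \<open>x\<close> and \<open>y\<close> of \<open>v\<close> are left,
  so \<open>v\<close> forces them onto one path, with ends \<open>a\<close> and \<open>x\<close>.
  The inner vertex \<open>y\<close> needs two of its neighbours \<open>v\<close>, \<open>c\<close>,
  \<open>d\<close>, which brings an end of the other pair onto this path.\<close>

lemma not_free_3_1_1_1:
  "\<exists>F. is_fault 4 F \<and> mass F = 3 \<and> charge F = 1 \<and> \<not> can_freely_prescribe_ends 4 F 1 1"
proof -
  define v x y where "v = [True, False, False, False]" and "x = [True, False, True, False]"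
    and "y = [True, False, False, True]"
  define a c d where "a = [False, True, False, False]" and "c = [True, True, False, True]"
    and "d = [True, False, True, True]"
  define F where "F = {[False, False, False, False], [True, True, False, False], [False, False, False, True]}"
  define E where "E = {{a, x}, {c, d}}"
  note defs = v_def x_def y_def a_def c_def d_def
  have "cls F True = {[False, False, False, False], [True, True, False, False]}"
    "cls F False = {[False, False, False, True]}"
    by (auto simp: F_def cls_def red_def)
  moreover have "is_fault 4 F" by (simp add: is_fault_def hypercube_def F_def)
  ultimately have F: "is_fault 4 F" "mass F = 3" "red_minus_green F = 1"
    using fault_colours(3,4)[of 4 F] by simp_all
  have "admissible_ends 4 F 1 1 E"
    unfolding E_def by (subst admissible_two) (use F(3) in \<open>auto simp: F_def red_def defs\<close>)
  moreover have "\<not> (path_covering (faulty_hypercube 4 F) P \<and> path_ends ` P = E)" for P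
  proof
    assume P: "path_covering (faulty_hypercube 4 F) P \<and> path_ends ` P = E"
    have vy: "v \<in> vertices 4 - F" "v \<notin> \<Union>(path_ends ` P)" "y \<in> vertices 4 - F" "y \<notin> \<Union>(path_ends ` P)"
      using P by (simp_all add: defs F_def E_def)
    obtain p u w where p: "p \<in> P" "{u, w} \<subseteq> set p - F" "u \<noteq> w" "adjacent v u" "adjacent v w"
      by (rule covering_inner[OF conjunct1[OF P] vy(1,2)])
    have "z \<in> F \<union> {x, y}" if "adjacent v z" for z
      using that by (simp add: adjacent_iff_upt flip_def F_def defs) blast
    from this[OF p(4)] this[OF p(5)] have xy: "x \<in> set p" "y \<in> set p" using p(2,3) by blast+
    obtain q u' w' where q: "q \<in> P" "y \<in> set q" "{u', w'} \<subseteq> set q - F" "u' \<noteq> w'" "adjacent y u'" "adjacent y w'"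
      by (rule covering_inner[OF conjunct1[OF P] vy(3,4)])
    have "z \<in> F \<union> {v, c, d}" if "adjacent y z" for z
      using that by (simp add: adjacent_iff_upt flip_def F_def defs) blast
    from this[OF q(5)] this[OF q(6)] have "c \<in> set q \<or> d \<in> set q" using q(3,4) by blast
    moreover have "q = p"
      using P p(1) q(1,2) xy(2) unfolding path_covering_def pairwise_def disjnt_def by blast
    ultimately have "path_ends p = {c, d}"
      using covering_ends[of 4 F P p "{c, d}"] P p(1) by (auto simp: E_def)
    moreover have "path_ends p = {a, x}"
      using covering_ends[of 4 F P p "{a, x}" x] P p(1) xy(1) by (auto simp: E_def)
    ultimately show False by (auto simp: defs doubleton_eq_iff)
  qed
  ultimately show ?thesis
    using F by (intro exI[of _ F]) (auto simp: charge_def can_freely_prescribe_ends_def)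
qed

text \<open>The inner vertex \<open>v\<close> has only the neighbours \<open>p\<close> and
  \<open>q\<close> left and joins them, although they are prescribed as ends of different
  paths.\<close>

lemma not_free_2_0_2_0:
  "\<exists>F. is_fault 3 F \<and> mass F = 2 \<and> charge F = 0 \<and> \<not> can_freely_prescribe_ends 3 F 2 0"
proof -
  define v p q where "v = [True, False, False]" and "p = [True, True, False]" and "q = [True, False, True]"
  define s t where "s = [False, True, False]" and "t = [False, False, True]"
  define F where "F = {[False, False, False], [True, True, True]}"
  define E where "E = {{p, s}, {q, t}}"
  note defs = v_def p_def q_def s_def t_def
  have "cls F True = {[False, False, False]}" "cls F False = {[True, True, True]}"
    by (auto simp: F_def cls_def red_def)
  moreover have "is_fault 3 F" by (simp add: is_fault_def hypercube_def F_def)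
  ultimately have F: "is_fault 3 F" "mass F = 2" "red_minus_green F = 0"
    using fault_colours(3,4)[of 3 F] by simp_all
  have "admissible_ends 3 F 2 0 E"
    unfolding E_def by (subst admissible_two) (use F(3) in \<open>auto simp: F_def red_def defs\<close>)
  moreover have "\<not> (path_covering (faulty_hypercube 3 F) P \<and> path_ends ` P = E)" for P
  proof
    assume P: "path_covering (faulty_hypercube 3 F) P \<and> path_ends ` P = E"
    have v: "v \<in> vertices 3 - F" "v \<notin> \<Union>(path_ends ` P)"
      using P by (simp_all add: defs F_def E_def)
    obtain l u w where l: "l \<in> P" "{u, w} \<subseteq> set l - F" "u \<noteq> w" "adjacent v u" "adjacent v w"
      by (rule covering_inner[OF conjunct1[OF P] v])
    have "z \<in> F \<union> {p, q}" if "adjacent v z" for z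
      using that by (simp add: adjacent_iff_upt flip_def F_def defs) blast
    from this[OF l(4)] this[OF l(5)] have "p \<in> set l" "q \<in> set l" using l(2,3) by blast+
    then have "path_ends l = {p, s}" "path_ends l = {q, t}"
      using covering_ends[of 3 F P l "{p, s}" p] covering_ends[of 3 F P l "{q, t}" q] P l(1)
      by (auto simp: E_def)
    then show False by (auto simp: defs doubleton_eq_iff)
  qed
  ultimately show ?thesis
    using F by (intro exI[of _ F]) (auto simp: charge_def can_freely_prescribe_ends_def)
qed

text \<open>A failure in dimension \<open>m\<close> excludes every number up to \<open>m\<close>,
  because an element of \<open>dims\<close> bounds all dimensions from there on.\<close>

lemma least_dimI:
  assumes "d = Suc m" "M + C + 2 * N + 2 * Ch \<le> 2 ^ d" "0 < M"
    and free: "\<And>n F. d \<le> n \<Longrightarrow> is_fault n F \<Longrightarrow> mass F = M \<Longrightarrow> charge F = C \<Longrightarrow>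
      can_freely_prescribe_ends n F N Ch"
    and not_free: "\<exists>F. is_fault m F \<and> mass F = M \<and> charge F = C \<and> \<not> can_freely_prescribe_ends m F N Ch"
  shows "dims M C N Ch \<noteq> {} \<and> least_dim M C N Ch = d"
proof -
  have "real (M + C + 2 * N + 2 * Ch) \<le> 2 ^ d"
    using assms(2) by (metis of_nat_le_iff of_nat_numeral of_nat_power)
  then have "log 2 (real (M + C + 2 * N + 2 * Ch)) \<le> real d"
    using assms(3) by (intro log_of_power_le) auto
  then have mem: "d \<in> dims M C N Ch"
    using free by (auto simp: dims_def)
  have "d \<le> y" if "y \<in> dims M C N Ch" for y
  proof -
    have "\<not> y \<le> m" using that not_free by (auto simp: dims_def)
    then show ?thesis using assms(1) by simp
  qed
  with mem have "least_dim M C N Ch = d"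
    unfolding least_dim_def by (rule Least_equality)
  then show ?thesis using mem by blast
qed

theorem lemma5p6:
  shows "dims 4 2 0 2 \<noteq> {} \<and> least_dim 4 2 0 2 = 5
    \<and> dims 3 1 1 1 \<noteq> {} \<and> least_dim 3 1 1 1 = 5
    \<and> dims 2 0 2 0 \<noteq> {} \<and> least_dim 2 0 2 0 = 4"
proof -
  have "dims 4 2 0 2 \<noteq> {} \<and> least_dim 4 2 0 2 = 5"
    by (rule least_dimI[OF _ _ _ free_4_2_0_2 not_free_4_2_0_2]) simp_all
  moreover have "dims 3 1 1 1 \<noteq> {} \<and> least_dim 3 1 1 1 = 5"
    by (rule least_dimI[OF _ _ _ free_3_1_1_1 not_free_3_1_1_1]) simp_all
  moreover have "dims 2 0 2 0 \<noteq> {} \<and> least_dim 2 0 2 0 = 4"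
    by (rule least_dimI[OF _ _ _ free_2_0_2_0 not_free_2_0_2_0]) simp_all
  ultimately show ?thesis by blast
qed

end
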